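(* Let $(\Lambda(U\oplus V),d)$ be a minimal Sullivan algebra over $\mathbb{Q}$ (with $U\oplus V$ concentrated in degrees $\geq 2$) which is elliptic, i.e. $\dim(U\oplus V)<\infty$ and $\dim H(\Lambda(U\oplus V),d)<\infty$, and which is a $2$-stage algebra, i.e. $d(U)=0$ and $d(V)\subseteq \Lambda U$ (no a priori restriction on the parity of degrees of $U$ and $V$). Then $$\dim H(\Lambda(U\oplus V),d)\;\geq\; \dim (U\oplus V).$$ Equivalently, every simply connected rationally elliptic space whose minimal Sullivan model is of this form satisfies the Hilali conjecture $\dim H^*(X;\mathbb{Q})\geq \dim \pi_*(X)\otimes\mathbb{Q}$.
   Context: For a minimal Sullivan model $(\Lambda W,d)$ of a simply connected space $X$, $\dim W=\dim \pi_*(X)\otimes\mathbb{Q}$ and $H(\Lambda W,d)\cong H^*(X;\mathbb{Q})$. The Hilali conjecture for such an algebra is the inequality $\dim H(\Lambda W,d)\geq \dim W$. *)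

theory Defs
  imports Complex_Main "HOL-Library.Function_Algebras"
begin

text \<open>
  Free graded-commutative algebra \<Lambda>W over the rationals on N homogeneous generators
  x_0, ..., x_(N-1), where generator x_i has degree deg i.
  A monomial is an exponent function e :: nat \<Rightarrow> nat (zero outside {..<N}, at most 1 on
  odd-degree generators) and stands for the ordered product x_0^(e 0) x_1^(e 1) ... .
  Elements of \<Lambda>W are finitely supported rational-valued functions on monomials.
\<close>

type_synonym mono = "nat \<Rightarrow> nat"
type_synonym elem = "mono \<Rightarrow> rat"

definition esupp :: "elem \<Rightarrow> mono set" where
  "esupp f = {m. f m \<noteq> 0}"

definition monoms :: "nat \<Rightarrow> (nat \<Rightarrow> nat) \<Rightarrow> mono set" where
  "monoms N deg = {e. (\<forall>i. N \<le> i \<longrightarrow> e i = 0) \<and> (\<forall>i. odd (deg i) \<longrightarrow> e i \<le> 1)}"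

definition mdeg :: "nat \<Rightarrow> (nat \<Rightarrow> nat) \<Rightarrow> mono \<Rightarrow> nat" where
  "mdeg N deg e = (\<Sum>i<N. e i * deg i)"

definition mlen :: "nat \<Rightarrow> mono \<Rightarrow> nat" where
  "mlen N e = (\<Sum>i<N. e i)"

definition elems :: "nat \<Rightarrow> (nat \<Rightarrow> nat) \<Rightarrow> elem set" where
  "elems N deg = {f. finite (esupp f) \<and> esupp f \<subseteq> monoms N deg}"

definition homog :: "nat \<Rightarrow> (nat \<Rightarrow> nat) \<Rightarrow> nat \<Rightarrow> elem \<Rightarrow> bool" where
  "homog N deg n f \<longleftrightarrow> f \<in> elems N deg \<and> (\<forall>e\<in>esupp f. mdeg N deg e = n)"

text \<open>Koszul sign for the product of two normally ordered monomials\<close>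
definition msign :: "(nat \<Rightarrow> nat) \<Rightarrow> mono \<Rightarrow> mono \<Rightarrow> rat" where
  "msign deg a b = (-1) ^ card {(i, j). j < i \<and> odd (deg i) \<and> odd (deg j) \<and> a i \<noteq> 0 \<and> b j \<noteq> 0}"

definition mmul :: "(nat \<Rightarrow> nat) \<Rightarrow> mono \<Rightarrow> mono \<Rightarrow> elem" where
  "mmul deg a b = (\<lambda>e. if e = (\<lambda>i. a i + b i) \<and> \<not> (\<exists>i. odd (deg i) \<and> a i \<noteq> 0 \<and> b i \<noteq> 0)
                       then msign deg a b else 0)"

definition amul :: "(nat \<Rightarrow> nat) \<Rightarrow> elem \<Rightarrow> elem \<Rightarrow> elem" where
  "amul deg f g = (\<lambda>e. \<Sum>(a, b) \<in> esupp f \<times> esupp g. f a * g b * mmul deg a b e)"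

definition qscale :: "rat \<Rightarrow> elem \<Rightarrow> elem" where
  "qscale c f = (\<lambda>e. c * f e)"

definition gen :: "nat \<Rightarrow> elem" where
  "gen i = (\<lambda>e. if e = (\<lambda>j. if j = i then 1 else 0) then 1 else 0)"

definition sullivan_alg :: "nat \<Rightarrow> (nat \<Rightarrow> nat) \<Rightarrow> (elem \<Rightarrow> elem) \<Rightarrow> bool" where
  "sullivan_alg N deg D \<longleftrightarrow>
     (\<forall>i<N. 2 \<le> deg i) \<and>
     (\<forall>f\<in>elems N deg. \<forall>g\<in>elems N deg. D (f + g) = D f + D g) \<and>
     (\<forall>c. \<forall>f\<in>elems N deg. D (qscale c f) = qscale c (D f)) \<and>
     (\<forall>n f. homog N deg n f \<longrightarrow> homog N deg (n + 1) (D f)) \<and>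
     (\<forall>n a b. homog N deg n a \<longrightarrow> b \<in> elems N deg \<longrightarrow>
        D (amul deg a b) = amul deg (D a) b + qscale ((-1) ^ n) (amul deg a (D b))) \<and>
     (\<forall>f\<in>elems N deg. D (D f) = 0)"

definition minimal :: "nat \<Rightarrow> (elem \<Rightarrow> elem) \<Rightarrow> bool" where
  "minimal N D \<longleftrightarrow> (\<forall>i<N. \<forall>e\<in>esupp (D (gen i)). 2 \<le> mlen N e)"

text \<open>two-stage: W = U \<oplus> V with U spanned by the generators indexed by Us,
  V by the remaining ones; D(U) = 0 and D(V) \<subseteq> \<Lambda>U\<close>
definition two_stage :: "nat \<Rightarrow> (elem \<Rightarrow> elem) \<Rightarrow> nat set \<Rightarrow> bool" where
  "two_stage N D Us \<longleftrightarrow> Us \<subseteq> {..<N} \<and>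
     (\<forall>i\<in>Us. D (gen i) = 0) \<and>
     (\<forall>i<N. i \<notin> Us \<longrightarrow> (\<forall>e\<in>esupp (D (gen i)). \<forall>j<N. j \<notin> Us \<longrightarrow> e j = 0))"

definition qdim :: "elem set \<Rightarrow> nat" where
  "qdim S = vector_space.dim qscale S"

definition cocycles :: "nat \<Rightarrow> (nat \<Rightarrow> nat) \<Rightarrow> (elem \<Rightarrow> elem) \<Rightarrow> nat \<Rightarrow> elem set" where
  "cocycles N deg D n = {f. homog N deg n f \<and> D f = 0}"

definition coboundaries :: "nat \<Rightarrow> (nat \<Rightarrow> nat) \<Rightarrow> (elem \<Rightarrow> elem) \<Rightarrow> nat \<Rightarrow> elem set" where
  "coboundaries N deg D n = (if n = 0 then {0} else D ` {f. homog N deg (n - 1) f})"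

definition Hdim :: "nat \<Rightarrow> (nat \<Rightarrow> nat) \<Rightarrow> (elem \<Rightarrow> elem) \<Rightarrow> nat \<Rightarrow> nat" where
  "Hdim N deg D n = qdim (cocycles N deg D n) - qdim (coboundaries N deg D n)"

text \<open>elliptic: dim W = N < \<infinity> automatically; total cohomology finite-dimensional\<close>
definition elliptic :: "nat \<Rightarrow> (nat \<Rightarrow> nat) \<Rightarrow> (elem \<Rightarrow> elem) \<Rightarrow> bool" where
  "elliptic N deg D \<longleftrightarrow> finite {n. Hdim N deg D n \<noteq> 0}"

definition total_Hdim :: "nat \<Rightarrow> (nat \<Rightarrow> nat) \<Rightarrow> (elem \<Rightarrow> elem) \<Rightarrow> nat" where
  "total_Hdim N deg D = (\<Sum>n\<in>{n. Hdim N deg D n \<noteq> 0}. Hdim N deg D n)"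

end

theory Submission
  imports Defs "HOL-Computational_Algebra.Polynomial_FPS"
begin

text \<open>
  Write \<open>U = X \<oplus> Y\<close> (even and odd part), \<open>n = |X|\<close>, \<open>s = |Y|\<close>, \<open>t = dim V\<close>. The differential lowers the
  word length in \<open>V\<close> by one, so cohomology splits as \<open>H = \<Oplus>H\<^sub>k\<close>. Finiteness of \<open>H\<close> forces \<open>V\<close> to be
  concentrated in odd degrees; the complex is then a Koszul complex over \<open>\<Lambda>U\<close> on \<open>t\<close> elements of positive
  degree. Counting monomials by (degree + \<open>V\<close>-length), the polynomial \<open>E\<close> of signed dimensions of \<open>H\<close>
  satisfies \<open>E \<cdot> \<Prod>\<^sub>X (1 - q\<^sup>x) = \<Prod>\<^sub>Y (1 + q\<^sup>y) \<cdot> \<Prod>\<^sub>V (1 - q\<^sup>v\<^sup>+\<^sup>1)\<close>; comparing orders of vanishing at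
  \<open>q = 1\<close> gives \<open>r = t - n \<ge> 0\<close>, and \<open>\<Sum>(-1)\<^sup>k dim H\<^sub>k = 0\<close> if \<open>r > 0\<close>.

  By minimality the classes of \<open>1\<close> and of the generators of \<open>U\<close> are independent, so \<open>dim H\<^sub>0 \<ge> 1 + n + s\<close>.
  Koszul homology is rigid: \<open>H\<^sub>k = 0\<close> implies \<open>H\<^sub>j = 0\<close> for all \<open>j \<ge> k\<close>; dividing by \<open>X\<close> raises this bound by
  at most \<open>n\<close>, while the product of all odd generators is a nontrivial class of \<open>V\<close>-length \<open>t\<close> modulo \<open>X\<close>.
  Hence \<open>H\<^sub>k \<noteq> 0\<close> for \<open>k \<le> r\<close>. If \<open>r > 0\<close>, then \<open>dim H\<close> is twice the sum of the \<open>dim H\<^sub>k\<close> with \<open>k\<close> even, at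
  least \<open>2 (1 + n + s + \<lfloor>r/2\<rfloor>) \<ge> 2 n + s + r\<close>. If \<open>r = 0\<close>, the \<open>t = n\<close> relations cannot kill enough quadratic
  monomials in \<open>X\<close> for \<open>dim H\<^sub>0\<close> to drop below \<open>2 n + s\<close>.
\<close>

section \<open>Dimension of subspaces of finite-dimensional spaces\<close>

context vector_space
begin

text \<open>An infinite-dimensional space has \<open>dim\<close> 0, the cardinality of an infinite
  basis, so monotonicity fails without a finite \<open>F\<close>. The counts below therefore take
  place inside the span of a finite set.\<close>

lemma dim_mono_finite:
  assumes "V \<subseteq> span W" "W \<subseteq> span F" "finite F"
  shows "dim V \<le> dim W"
proof -
  obtain B where B: "B \<subseteq> W" "independent B" "W \<subseteq> span B" "card B = dim W"
    by (rule basis_exists)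
  have "finite B"
    using independent_span_bound[OF assms(3) B(2)] B(1) assms(2) by auto
  moreover have "V \<subseteq> span B"
    using assms(1) B(3) span_minimal[OF B(3) subspace_span] by auto
  ultimately show ?thesis
    using dim_le_card[of V B] B(4) by simp
qed

lemma span_eq_if_dim_le:
  assumes "subspace V" "V \<subseteq> W" "W \<subseteq> span F" "finite F" "dim W \<le> dim V"
  shows "V = W"
proof -
  obtain B where B: "B \<subseteq> V" "independent B" "V \<subseteq> span B" "card B = dim V"
    by (rule basis_exists)
  have fB: "finite B"
    using independent_span_bound[OF assms(4) B(2)] B(1) assms(2,3) by auto
  have "w \<in> V" if "w \<in> W" for w
  proof (rule ccontr)
    assume w: "w \<notin> V"
    have "span B \<subseteq> V" using B(1) assms(1) by (rule span_minimal)
    then have "w \<notin> span B" using w by auto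
    then have i: "independent (insert w B)" "w \<notin> B"
      using B(2) independent_insertI span_base by auto
    have "dim (insert w B) = Suc (dim V)"
      using dim_eq_card_independent[OF i(1)] i(2) fB B(4) by simp
    moreover have "dim (insert w B) \<le> dim W"
      by (rule dim_mono_finite[OF _ assms(3,4)]) (use that B(1) assms(2) span_base in auto)
    ultimately show False using assms(5) by simp
  qed
  then show ?thesis using assms(2) by auto
qed

text \<open>Linearity is asked for on \<open>V\<close> only, because \<open>D\<close> is known to be
  linear only on \<open>elems N deg\<close>. A basis \<open>A\<close> of the kernel is extended to a
  basis \<open>B\<close> of \<open>V\<close>, and \<open>f\<close> maps \<open>B - A\<close>
  bijectively onto a basis of the image.\<close>

lemma rank_nullity_on:
  assumes V: "subspace V" "V \<subseteq> span F" "finite F"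
    and add: "\<And>x y. x \<in> V \<Longrightarrow> y \<in> V \<Longrightarrow> f (x + y) = f x + f y"
    and scl: "\<And>c x. x \<in> V \<Longrightarrow> f (scale c x) = scale c (f x)"
  shows "dim V = dim {x \<in> V. f x = 0} + dim (f ` V)"
proof -
  let ?K = "{x \<in> V. f x = 0}"
  have f0: "f 0 = 0"
    using scl[of 0 0] V(1) by (simp add: subspace_0)
  have sK: "subspace ?K"
    using V(1) f0 by (auto intro!: subspaceI simp: subspace_0 subspace_add subspace_scale add scl)
  obtain A where A: "A \<subseteq> ?K" "independent A" "?K \<subseteq> span A" "card A = dim ?K"
    by (rule basis_exists)
  obtain B where B: "A \<subseteq> B" "B \<subseteq> V" "independent B" "V \<subseteq> span B"
    using maximal_independent_subset_extend[of A V] A(1,2) by blast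
  have fB: "finite B"
    using independent_span_bound[OF V(3) B(3)] B(2) V(2) by auto
  then have fA: "finite A" using B(1) finite_subset by blast
  define C where "C = B - A"
  have fC: "finite C" "C \<subseteq> V" using fB B(2) by (auto simp: C_def)
  have dV: "dim V = card B" using basis_card_eq_dim[OF B(2,4,3)] by simp
  have f_sum: "(\<Sum>v\<in>S. scale (u v) v) \<in> V \<and> f (\<Sum>v\<in>S. scale (u v) v) = (\<Sum>v\<in>S. scale (u v) (f v))"
    if "finite S" "S \<subseteq> V" for S u
    using that
  proof (induction S rule: finite_induct)
    case empty
    then show ?case using f0 V(1) by (simp add: subspace_0)
  next
    case (insert x S)
    then have "scale (u x) x \<in> V" using V(1) by (simp add: subspace_scale)
    with insert show ?case using V(1) by (simp add: add scl subspace_add)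
  qed
  have zero: "\<forall>v\<in>C. u v = 0" if "(\<Sum>v\<in>C. scale (u v) (f v)) = 0" for u
  proof -
    let ?w = "\<Sum>v\<in>C. scale (u v) v"
    have "?w \<in> ?K" using f_sum[OF fC] that by simp
    then have "?w \<in> span A" using A(3) by auto
    then obtain t where t: "?w = (\<Sum>v\<in>A. scale (t v) v)"
      using span_finite[OF fA] by auto
    \<comment> \<open>Subtracting the expansion of \<open>?w\<close> in \<open>A\<close> turns a
      relation among the images of \<open>C\<close> into a relation on the basis
      \<open>B\<close>.\<close>
    define g where "g v = (if v \<in> A then - t v else u v)" for v
    have "(\<Sum>v\<in>B. scale (g v) v) = (\<Sum>v\<in>A. scale (g v) v) + (\<Sum>v\<in>C. scale (g v) v)"
      using B(1) fB unfolding C_def by (metis add.commute sum.subset_diff)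
    also have "(\<Sum>v\<in>A. scale (g v) v) = - ?w"
      unfolding t by (simp add: g_def sum_negf)
    also have "(\<Sum>v\<in>C. scale (g v) v) = ?w"
      by (rule sum.cong) (auto simp: g_def C_def)
    finally have "(\<Sum>v\<in>B. scale (g v) v) = 0" by simp
    then have "\<forall>v\<in>B. g v = 0"
      using B(3) fB dependent_finite by auto
    then show ?thesis by (auto simp: g_def C_def)
  qed
  have inj: "inj_on f C"
  proof (rule inj_onI, rule ccontr)
    fix x y assume xy: "x \<in> C" "y \<in> C" "f x = f y" "x \<noteq> y"
    define u where "u v = (if v = x then 1 else if v = y then - 1 else (0::'a))" for v
    have "(\<Sum>v\<in>C. scale (u v) (f v)) = (\<Sum>v\<in>{x,y}. scale (u v) (f v))"
      by (rule sum.mono_neutral_right) (use fC xy in \<open>auto simp: u_def\<close>)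
    also have "\<dots> = 0" using xy by (simp add: u_def)
    finally have "u x = 0" using zero xy by blast
    then show False by (simp add: u_def)
  qed
  have ind: "independent (f ` C)"
  proof (rule independent_if_scalars_zero)
    show "finite (f ` C)" using fC by simp
    fix g x assume "(\<Sum>x\<in>f ` C. scale (g x) x) = 0" "x \<in> f ` C"
    then show "g x = 0"
      using zero[of "g \<circ> f"] by (auto simp: sum.reindex[OF inj])
  qed
  have "f ` V \<subseteq> span (f ` C)"
  proof
    fix y assume "y \<in> f ` V"
    then obtain x where x: "x \<in> V" "y = f x" by auto
    then have "x \<in> span B" using B(4) by auto
    then obtain u where u: "x = (\<Sum>v\<in>B. scale (u v) v)"
      using span_finite[OF fB] by auto
    have "y = (\<Sum>v\<in>B. scale (u v) (f v))"
      using f_sum[OF fB B(2), of u] u x by simp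
    also have "\<dots> = (\<Sum>v\<in>C. scale (u v) (f v))"
      by (rule sum.mono_neutral_right) (use fB A(1) in \<open>auto simp: C_def\<close>)
    also have "\<dots> \<in> span (f ` C)"
      by (intro span_sum span_scale span_base) auto
    finally show "y \<in> span (f ` C)" .
  qed
  moreover have "f ` C \<subseteq> f ` V" using fC by auto
  ultimately have "dim (f ` V) = card (f ` C)"
    using basis_card_eq_dim[of "f ` C" "f ` V"] ind by simp
  also have "\<dots> = card C" using inj by (rule card_image)
  also have "\<dots> = card B - card A" unfolding C_def using fA B(1) by (rule card_Diff_subset)
  finally show ?thesis
    using dV A(4) card_mono[OF fB B(1)] by simp
qed

end

section \<open>Finitely supported functions on monomials\<close>

interpretation Q: vector_space qscale
  by standard (auto simp: qscale_def fun_eq_iff algebra_simps)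

lemma qdim_eq: "qdim S = Q.dim S"
  by (simp add: qdim_def)

lemma qscale_apply: "qscale c f e = c * f e"
  by (simp add: qscale_def)

text \<open>Bigraded pieces, ideals generated by generators and their complements are all spans of
  monomials, so that membership reduces to statements about exponents.\<close>

definition supported :: "mono set \<Rightarrow> elem set" where
  "supported S = {f. finite (esupp f) \<and> esupp f \<subseteq> S}"

definition mon :: "mono \<Rightarrow> elem" where
  "mon m = (\<lambda>e. if e = m then 1 else 0)"

definition proj :: "mono set \<Rightarrow> elem \<Rightarrow> elem" where
  "proj S f = (\<lambda>e. if e \<in> S then f e else 0)"

lemma esupp_mon [simp]: "esupp (mon m) = {m}"
  by (auto simp: esupp_def mon_def)

lemma esupp_0 [simp]: "esupp 0 = {}"
  by (auto simp: esupp_def)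

lemma esupp_eq_empty: "esupp f = {} \<longleftrightarrow> f = 0"
  by (auto simp: esupp_def fun_eq_iff)

lemma esupp_add: "esupp (f + g) \<subseteq> esupp f \<union> esupp g"
  by (auto simp: esupp_def)

lemma esupp_diff: "esupp (f - g) \<subseteq> esupp f \<union> esupp g"
  by (auto simp: esupp_def)

lemma esupp_qscale: "esupp (qscale c f) \<subseteq> esupp f"
  by (auto simp: esupp_def qscale_def)

lemma esupp_proj: "esupp (proj S f) = esupp f \<inter> S"
  by (auto simp: esupp_def proj_def)

lemma elems_supported: "elems N deg = supported (monoms N deg)"
  by (auto simp: elems_def supported_def)

lemma subspace_supported: "Q.subspace (supported S)"
  unfolding supported_def
  by (rule Q.subspaceI)
    (auto dest: subsetD[OF esupp_add] subsetD[OF esupp_qscale]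
      intro: finite_subset[OF esupp_add] finite_subset[OF esupp_qscale])

lemma supported_0 [simp]: "0 \<in> supported S"
  by (simp add: supported_def)

lemma supported_add: "f \<in> supported S \<Longrightarrow> g \<in> supported S \<Longrightarrow> f + g \<in> supported S"
  using subspace_supported Q.subspace_add by blast

lemma supported_diff: "f \<in> supported S \<Longrightarrow> g \<in> supported S \<Longrightarrow> f - g \<in> supported S"
  using subspace_supported Q.subspace_diff by blast

lemma supported_qscale: "f \<in> supported S \<Longrightarrow> qscale c f \<in> supported S"
  using subspace_supported Q.subspace_scale by blast

lemma supported_sum: "(\<And>i. i \<in> I \<Longrightarrow> f i \<in> supported S) \<Longrightarrow> sum f I \<in> supported S"
  using subspace_supported Q.subspace_sum by blast

lemma supported_mono: "S \<subseteq> T \<Longrightarrow> supported S \<subseteq> supported T"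
  by (auto simp: supported_def)

lemma supported_empty: "supported {} = {0}"
  by (auto simp: supported_def esupp_eq_empty)

lemma supported_Int: "supported S \<inter> supported T = supported (S \<inter> T)"
  by (auto simp: supported_def)

lemma supported_proj: "f \<in> supported S \<Longrightarrow> proj T f \<in> supported (S \<inter> T)"
  by (auto simp: supported_def esupp_proj)

lemma supportedD: "f \<in> supported S \<Longrightarrow> f e \<noteq> 0 \<Longrightarrow> e \<in> S"
  by (auto simp: supported_def esupp_def)

lemma mon_supported [simp]: "mon m \<in> supported S \<longleftrightarrow> m \<in> S"
  by (simp add: supported_def)

lemma proj_id: "f \<in> supported S \<Longrightarrow> proj S f = f"
  by (auto simp: supported_def proj_def esupp_def fun_eq_iff)

lemma proj_eq_0: "f \<in> supported T \<Longrightarrow> S \<inter> T = {} \<Longrightarrow> proj S f = 0"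
  by (auto simp: supported_def proj_def esupp_def fun_eq_iff)

lemma proj_add: "proj S (f + g) = proj S f + proj S g"
  by (auto simp: proj_def fun_eq_iff)

lemma proj_qscale: "proj S (qscale c f) = qscale c (proj S f)"
  by (auto simp: proj_def fun_eq_iff qscale_def)

lemma proj_0 [simp]: "proj S 0 = 0"
  by (simp add: proj_def fun_eq_iff)

lemma proj_split: "f = proj S f + proj (- S) f"
  by (auto simp: proj_def fun_eq_iff)

lemma sum_fun_apply: "(\<Sum>i\<in>I. (f i :: elem)) e = (\<Sum>i\<in>I. f i e)"
  by (induction I rule: infinite_finite_induct) auto

lemma expand_mon:
  assumes "finite S" "esupp f \<subseteq> S"
  shows "f = (\<Sum>m\<in>S. qscale (f m) (mon m))"
proof
  fix e
  have "(\<Sum>m\<in>S. qscale (f m) (mon m)) e = (\<Sum>m\<in>S. if m = e then f m else 0)"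
    unfolding sum_fun_apply by (rule sum.cong) (auto simp: qscale_def mon_def)
  also have "\<dots> = f e" using assms by (auto simp: sum.delta esupp_def)
  finally show "f e = (\<Sum>m\<in>S. qscale (f m) (mon m)) e" by simp
qed

lemma inj_mon: "inj mon"
  by (rule injI) (metis esupp_mon singleton_inject)

lemma supported_span: "finite S \<Longrightarrow> supported S \<subseteq> Q.span (mon ` S)"
proof
  fix f assume "finite S" "f \<in> supported S"
  then have "f = (\<Sum>m\<in>S. qscale (f m) (mon m))"
    using expand_mon by (auto simp: supported_def)
  also have "\<dots> \<in> Q.span (mon ` S)"
    by (intro Q.span_sum Q.span_scale Q.span_base) auto
  finally show "f \<in> Q.span (mon ` S)" .
qed

section \<open>Dimensions of spans of monomials and of graded subspaces\<close>

lemma dim_supported: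
  assumes "finite S"
  shows "Q.dim (supported S) = card S"
proof (rule Q.dim_unique[of "mon ` S"])
  show "Q.independent (mon ` S)"
  proof (rule Q.independent_if_scalars_zero)
    show "finite (mon ` S)" using assms by simp
    fix g x assume g: "(\<Sum>x\<in>mon ` S. qscale (g x) x) = 0" and x: "x \<in> mon ` S"
    then obtain m where m: "m \<in> S" "x = mon m" by auto
    have "0 = (\<Sum>x\<in>mon ` S. qscale (g x) x) m" using g by simp
    also have "\<dots> = (\<Sum>k\<in>S. qscale (g (mon k)) (mon k)) m"
      by (subst sum.reindex) (auto intro: inj_on_subset[OF inj_mon])
    also have "\<dots> = (\<Sum>k\<in>S. if k = m then g (mon k) else 0)"
      unfolding sum_fun_apply by (rule sum.cong) (auto simp: qscale_def mon_def)
    also have "\<dots> = g x" using assms m by simp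
    finally show "g x = 0" by simp
  qed
qed (use assms supported_span in \<open>auto simp: card_image inj_on_subset[OF inj_mon]\<close>)

text \<open>The two summands are the image and the kernel of \<open>proj A\<close> restricted to
  \<open>W\<close>.\<close>

lemma dim_split_proj:
  assumes S: "finite S" and W: "Q.subspace W" "W \<subseteq> supported S"
    and pr: "\<And>f. f \<in> W \<Longrightarrow> proj A f \<in> W"
  shows "Q.dim W = Q.dim (W \<inter> supported A) + Q.dim (W \<inter> supported (- A))"
proof -
  have "Q.dim W = Q.dim {x \<in> W. proj A x = 0} + Q.dim (proj A ` W)"
    by (rule Q.rank_nullity_on[of _ "mon ` S"])
      (use W S supported_span[OF S] in \<open>auto simp: proj_add proj_qscale\<close>)
  moreover have "{x \<in> W. proj A x = 0} = W \<inter> supported (- A)"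
  proof (intro set_eqI iffI)
    fix x assume "x \<in> {x \<in> W. proj A x = 0}"
    then show "x \<in> W \<inter> supported (- A)"
      using W by (auto simp: supported_def proj_def esupp_def fun_eq_iff split: if_splits)
  next
    fix x assume "x \<in> W \<inter> supported (- A)"
    then show "x \<in> {x \<in> W. proj A x = 0}"
      using proj_eq_0[of x "- A" A] by auto
  qed
  moreover have "proj A ` W = W \<inter> supported A"
  proof (intro set_eqI iffI)
    fix x assume "x \<in> proj A ` W"
    then show "x \<in> W \<inter> supported A"
      using pr W(2) supported_proj supported_mono[of "S \<inter> A" A] by blast
  next
    fix x assume "x \<in> W \<inter> supported A"
    then show "x \<in> proj A ` W" using proj_id[of x A] by (auto intro: image_eqI[of _ _ x])
  qed
  ultimately show ?thesis by simp
qed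

lemma dim_graded:
  fixes g :: "mono \<Rightarrow> nat"
  assumes S: "finite S" and W: "Q.subspace W" "W \<subseteq> supported S"
    and pr: "\<And>f k. f \<in> W \<Longrightarrow> proj {e. g e = k} f \<in> W"
    and bd: "\<And>e. e \<in> S \<Longrightarrow> g e \<le> n"
  shows "Q.dim W = (\<Sum>k\<le>n. Q.dim (W \<inter> supported {e. g e = k}))"
  using assms
proof (induction n arbitrary: W S)
  case 0
  then have "S \<subseteq> {e. g e = 0}" by auto
  then have "W \<inter> supported {e. g e = 0} = W"
    using 0(3) supported_mono by blast
  then show ?case by simp
next
  case (Suc n)
  let ?A = "{e. g e = Suc n}"
  let ?W = "W \<inter> supported (- ?A)"
  have comm: "proj {e. g e = k} f \<in> supported (- ?A)" if "f \<in> supported (- ?A)" for k f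
    using that by (auto simp: supported_def esupp_proj)
  have "Q.dim W = Q.dim (W \<inter> supported ?A) + Q.dim ?W"
    by (rule dim_split_proj[OF Suc.prems(1-3)]) (rule Suc.prems(4))
  also have "Q.dim ?W = (\<Sum>k\<le>n. Q.dim (?W \<inter> supported {e. g e = k}))"
  proof (rule Suc.IH[of "S - ?A"])
    show "Q.subspace ?W" using Suc.prems(2) subspace_supported Q.subspace_inter by blast
    show "?W \<subseteq> supported (S - ?A)"
      using Suc.prems(3) by (auto simp: supported_def)
    show "g e \<le> n" if "e \<in> S - ?A" for e
      using Suc.prems(5)[of e] that by (auto simp: le_Suc_eq)
  qed (use Suc.prems comm in auto)
  also have "\<dots> = (\<Sum>k\<le>n. Q.dim (W \<inter> supported {e. g e = k}))"
  proof (rule sum.cong[OF refl])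
    fix k assume "k \<in> {..n}"
    then have "{e. g e = k} \<subseteq> - ?A" by auto
    then have "?W \<inter> supported {e. g e = k} = W \<inter> supported {e. g e = k}"
      using supported_mono by blast
    then show "Q.dim (?W \<inter> supported {e. g e = k}) = Q.dim (W \<inter> supported {e. g e = k})" by simp
  qed
  finally show ?case by simp
qed

section \<open>Multiplication by a generator\<close>

definition unit_mono :: "nat \<Rightarrow> mono" where
  "unit_mono i = (\<lambda>j. if j = i then 1 else 0)"

lemma unit_mono_simps [simp]: "unit_mono i i = 1" "j \<noteq> i \<Longrightarrow> unit_mono i j = 0"
  by (auto simp: unit_mono_def)

lemma gen_eq_mon: "gen i = mon (unit_mono i)"
  by (simp add: gen_def mon_def unit_mono_def)

abbreviation inc :: "nat \<Rightarrow> mono \<Rightarrow> mono" where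
  "inc i m \<equiv> m(i := Suc (m i))"

abbreviation dec :: "nat \<Rightarrow> mono \<Rightarrow> mono" where
  "dec i m \<equiv> m(i := m i - 1)"

lemma inc_eq_add: "inc i m = (\<lambda>j. m j + unit_mono i j)"
  by (auto simp: unit_mono_def fun_eq_iff)

lemma msign_sq [simp]: "msign deg a b * msign deg a b = 1"
  by (simp add: msign_def flip: power_add)

lemma msign_nz [simp]: "msign deg a b \<noteq> 0"
  by (simp add: msign_def)

lemma amul_mon:
  assumes "finite (esupp f)"
  shows "amul deg f (mon b) e = (\<Sum>a\<in>esupp f. f a * mmul deg a b e)"
proof -
  have "amul deg f (mon b) e = (\<Sum>x\<in>esupp f \<times> {b}. f (fst x) * mmul deg (fst x) b e)"
    unfolding amul_def esupp_mon by (rule sum.cong) (auto simp: mon_def)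
  also have "\<dots> = (\<Sum>a\<in>esupp f. f a * mmul deg a b e)"
    by (rule sum.reindex_bij_witness[of _ "\<lambda>a. (a, b)" fst]) auto
  finally show ?thesis .
qed

text \<open>Only the term \<open>m\<close> of \<open>c\<close> can contribute to
  \<open>inc i m\<close>, and it does so with a sign. Right multiplication by a generator thus acts
  monomial by monomial and can be undone.\<close>

lemma amul_gen_inc:
  assumes "finite (esupp c)"
  shows "amul deg c (gen i) (inc i m) =
    (if odd (deg i) \<and> m i \<noteq> 0 then 0 else msign deg m (unit_mono i) * c m)"
proof -
  have eq: "inc i m = (\<lambda>j. a j + unit_mono i j) \<longleftrightarrow> a = m" for a
    unfolding inc_eq_add by (auto simp: fun_eq_iff)
  have ov: "(\<exists>j. odd (deg j) \<and> a j \<noteq> 0 \<and> unit_mono i j \<noteq> 0) \<longleftrightarrow> odd (deg i) \<and> a i \<noteq> 0" for a :: mono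
    by (auto simp: unit_mono_def)
  have "amul deg c (gen i) (inc i m) = (\<Sum>a\<in>esupp c. if a = m then
      (if odd (deg i) \<and> m i \<noteq> 0 then 0 else msign deg m (unit_mono i) * c m) else 0)"
    unfolding gen_eq_mon amul_mon[OF assms] mmul_def eq ov by (rule sum.cong) auto
  also have "\<dots> = (if odd (deg i) \<and> m i \<noteq> 0 then 0 else msign deg m (unit_mono i) * c m)"
    using assms by (auto simp: esupp_def)
  finally show ?thesis .
qed

lemma amul_gen_0:
  assumes "finite (esupp c)" "e i = 0"
  shows "amul deg c (gen i) e = 0"
  unfolding gen_eq_mon amul_mon[OF assms(1)]
  by (rule sum.neutral) (use assms(2) in \<open>auto simp: mmul_def\<close>)

lemma inc_dec: "m i > 0 \<Longrightarrow> inc i (dec i m) = m"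
  by auto

lemma amul_0_left [simp]: "amul deg 0 g = 0"
  by (auto simp: amul_def fun_eq_iff)

lemma amul_0_right [simp]: "amul deg f 0 = 0"
  by (auto simp: amul_def fun_eq_iff)

lemma mmul_nz: "mmul deg a b e \<noteq> 0 \<Longrightarrow>
    e = (\<lambda>i. a i + b i) \<and> (\<forall>i. odd (deg i) \<longrightarrow> a i = 0 \<or> b i = 0)"
  by (auto simp: mmul_def split: if_splits)

lemma amul_nz:
  assumes "amul deg f g e \<noteq> 0"
  obtains a b where "a \<in> esupp f" "b \<in> esupp g" "e = (\<lambda>i. a i + b i)"
    "\<forall>i. odd (deg i) \<longrightarrow> a i = 0 \<or> b i = 0"
proof -
  obtain p where p: "p \<in> esupp f \<times> esupp g"
    "(case p of (a, b) \<Rightarrow> f a * g b * mmul deg a b e) \<noteq> 0"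
    using assms unfolding amul_def by (meson sum.not_neutral_contains_not_neutral)
  obtain a b where ab: "p = (a, b)" by (cases p)
  then have "mmul deg a b e \<noteq> 0" using p by auto
  from mmul_nz[OF this] p ab show ?thesis using that[of a b] by simp
qed

lemma amul_supported:
  assumes "f \<in> supported S" "g \<in> supported T"
    and "\<And>a b. a \<in> S \<Longrightarrow> b \<in> T \<Longrightarrow> \<forall>i. odd (deg i) \<longrightarrow> a i = 0 \<or> b i = 0 \<Longrightarrow>
      (\<lambda>i. a i + b i) \<in> R"
  shows "amul deg f g \<in> supported R"
proof -
  have sub: "e \<in> R \<and> e \<in> (\<lambda>(a, b) i. a i + b i) ` (esupp f \<times> esupp g)"
    if nz: "amul deg f g e \<noteq> 0" for e
  proof -
    obtain a b where ab: "a \<in> esupp f" "b \<in> esupp g" "e = (\<lambda>i. a i + b i)"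
      and od: "\<forall>i. odd (deg i) \<longrightarrow> a i = 0 \<or> b i = 0"
      by (rule amul_nz[OF nz])
    have "e \<in> R" unfolding ab(3) using assms(3)[OF _ _ od] ab assms(1,2)
      by (auto simp: supported_def)
    moreover have "e \<in> (\<lambda>(a, b) i. a i + b i) ` (esupp f \<times> esupp g)"
      using ab by (intro image_eqI[of _ _ "(a,b)"]) auto
    ultimately show ?thesis by simp
  qed
  have "finite ((\<lambda>(a, b) i. a i + b i) ` (esupp f \<times> esupp g))"
    using assms(1,2) by (auto simp: supported_def)
  then have "finite (esupp (amul deg f g))"
    by (rule rev_finite_subset) (use sub in \<open>auto simp: esupp_def\<close>)
  then show ?thesis using sub by (auto simp: supported_def esupp_def)
qed

lemma amul_gen_supported:
  assumes "f \<in> supported S"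
    and "\<And>a. a \<in> S \<Longrightarrow> (odd (deg i) \<Longrightarrow> a i = 0) \<Longrightarrow> inc i a \<in> R"
  shows "amul deg f (gen i) \<in> supported R"
proof (rule amul_supported[OF assms(1), of "gen i" "{unit_mono i}"])
  show "gen i \<in> supported {unit_mono i}" by (simp add: gen_eq_mon)
  fix a b assume a: "a \<in> S" "b \<in> {unit_mono i}" "\<forall>j. odd (deg j) \<longrightarrow> a j = 0 \<or> b j = 0"
  have "odd (deg i) \<Longrightarrow> a i = 0" using a(2) a(3)[rule_format, of i] by simp
  then show "(\<lambda>j. a j + b j) \<in> R" using assms(2)[OF a(1)] a(2) unfolding inc_eq_add by simp
qed

lemma amul_gen_cases:
  assumes "finite (esupp c)"
  shows "amul deg c (gen i) e = (if e i = 0 \<or> odd (deg i) \<and> e i \<noteq> 1 then 0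
    else msign deg (dec i e) (unit_mono i) * c (dec i e))"
proof (cases "e i = 0")
  case True
  then show ?thesis using assms by (simp add: amul_gen_0)
next
  case False
  then have e: "inc i (dec i e) = e" by auto
  show ?thesis using amul_gen_inc[OF assms, of deg i "dec i e"] False unfolding e by auto
qed

lemma amul_gen_add:
  assumes "finite (esupp c)" "finite (esupp c')"
  shows "amul deg (c + c') (gen i) = amul deg c (gen i) + amul deg c' (gen i)"
proof -
  have "finite (esupp (c + c'))" using assms esupp_add finite_subset by blast
  then show ?thesis
    using assms by (auto simp: fun_eq_iff amul_gen_cases algebra_simps)
qed

text \<open>Right division by \<open>gen i\<close>: the Koszul sign squares to 1, so a second
  multiplication by it cancels it. For odd \<open>i\<close> the quotient has no terms containing
  \<open>i\<close>, since multiplication by \<open>gen i\<close> would kill them.\<close>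

definition rdiv :: "(nat \<Rightarrow> nat) \<Rightarrow> nat \<Rightarrow> elem \<Rightarrow> elem" where
  "rdiv deg i a = (\<lambda>m. if odd (deg i) \<and> m i \<noteq> 0 then 0 else msign deg m (unit_mono i) * a (inc i m))"

lemma inc_inj: "inc i m = inc i m' \<longleftrightarrow> m = m'"
  unfolding inc_eq_add by (auto simp: fun_eq_iff)

lemma rdiv_supported:
  assumes "a \<in> supported S"
    and "\<And>m. inc i m \<in> S \<Longrightarrow> (odd (deg i) \<Longrightarrow> m i = 0) \<Longrightarrow> m \<in> R"
  shows "rdiv deg i a \<in> supported R"
proof -
  have sub: "inc i m \<in> esupp a \<and> m \<in> R" if "rdiv deg i a m \<noteq> 0" for m
    using that assms by (auto simp: rdiv_def supported_def esupp_def split: if_splits)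
  have "finite (inc i -` esupp a)"
    using assms(1) by (intro finite_vimageI) (auto simp: supported_def intro: injI simp: inc_inj)
  then have "finite (esupp (rdiv deg i a))"
    by (rule rev_finite_subset) (use sub in \<open>auto simp: esupp_def\<close>)
  then show ?thesis using sub by (auto simp: supported_def esupp_def)
qed

lemma amul_rdiv:
  assumes "a \<in> supported S"
    and "\<And>e. e \<in> S \<Longrightarrow> e i > 0 \<and> (odd (deg i) \<longrightarrow> e i = 1)"
  shows "amul deg (rdiv deg i a) (gen i) = a"
proof
  fix e
  have f: "finite (esupp (rdiv deg i a))"
    using rdiv_supported[OF assms(1), of i deg UNIV] by (auto simp: supported_def)
  show "amul deg (rdiv deg i a) (gen i) e = a e"
  proof (cases "e i = 0 \<or> odd (deg i) \<and> e i \<noteq> 1")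
    case True
    then have "a e = 0" using assms supportedD by fastforce
    then show ?thesis using True f by (simp add: amul_gen_cases)
  next
    case False
    then have e: "inc i (dec i e) = e" by auto
    have "rdiv deg i a (dec i e) = msign deg (dec i e) (unit_mono i) * a e"
      unfolding rdiv_def e using False by auto
    then show ?thesis
      unfolding amul_gen_cases[OF f] using False by (auto simp flip: mult.assoc)
  qed
qed

lemma esupp_amul_gen_inc:
  assumes "finite (esupp c)" "m \<in> esupp c" "odd (deg i) \<Longrightarrow> m i = 0"
  shows "inc i m \<in> esupp (amul deg c (gen i))"
  using assms(2,3) amul_gen_inc[OF assms(1), of deg i m]
  by (cases "odd (deg i)") (auto simp: esupp_def)

section \<open>Two-stage algebras\<close>

lemma mdeg_add: "mdeg N deg (\<lambda>j. a j + b j) = mdeg N deg a + mdeg N deg b"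
  by (simp add: mdeg_def algebra_simps sum.distrib)

lemma mlen_add: "mlen N (\<lambda>j. a j + b j) = mlen N a + mlen N b"
  by (simp add: mlen_def sum.distrib)

lemma sum_unit_mono:
  assumes "finite A"
  shows "(\<Sum>j\<in>A. unit_mono i j * f j) = (if i \<in> A then f i else (0::nat))"
proof -
  have "(\<Sum>j\<in>A. unit_mono i j * f j) = (\<Sum>j\<in>A. if i = j then f i else 0)"
    by (rule sum.cong) (auto simp: unit_mono_def)
  also have "\<dots> = (if i \<in> A then f i else 0)"
    using assms by (rule sum.delta')
  finally show ?thesis .
qed

lemma mdeg_unit: "i < N \<Longrightarrow> mdeg N deg (unit_mono i) = deg i"
  unfolding mdeg_def by (simp add: sum_unit_mono)

lemma mlen_unit: "i < N \<Longrightarrow> mlen N (unit_mono i) = 1"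
  unfolding mlen_def using sum_unit_mono[of "{..<N}" i "\<lambda>_. 1"] by simp

lemma mdeg_inc: "i < N \<Longrightarrow> mdeg N deg (inc i m) = mdeg N deg m + deg i"
  unfolding inc_eq_add mdeg_add by (simp add: mdeg_unit)

lemma mlen_inc: "i < N \<Longrightarrow> mlen N (inc i m) = mlen N m + 1"
  unfolding inc_eq_add mlen_add by (simp add: mlen_unit)

lemma dec_monoms: "m \<in> monoms N deg \<Longrightarrow> dec i m \<in> monoms N deg"
  by (auto simp: monoms_def le_diff_conv le_Suc_eq)

lemma monoms_out: "m \<in> monoms N deg \<Longrightarrow> m i \<noteq> 0 \<Longrightarrow> i < N"
  by (auto simp: monoms_def not_less[symmetric])

lemma homog_iff: "homog N deg n f \<longleftrightarrow> f \<in> supported {e \<in> monoms N deg. mdeg N deg e = n}"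
  by (auto simp: homog_def elems_def supported_def)

locale two_stage_sullivan =
  fixes N :: nat and deg :: "nat \<Rightarrow> nat" and D :: "elem \<Rightarrow> elem" and Us :: "nat set"
  assumes sull: "sullivan_alg N deg D"
    and minim: "minimal N D"
    and stage: "two_stage N D Us"
begin

abbreviation Mon :: "mono set" where "Mon \<equiv> monoms N deg"
abbreviation \<A> :: "elem set" where "\<A> \<equiv> supported Mon"
abbreviation dg :: "mono \<Rightarrow> nat" where "dg \<equiv> mdeg N deg"

definition Vs :: "nat set" where "Vs = {..<N} - Us"
definition vlen :: "mono \<Rightarrow> nat" where "vlen e = (\<Sum>i\<in>Vs. e i)"

definition basis :: "nat set \<Rightarrow> nat \<Rightarrow> nat \<Rightarrow> mono set" where
  "basis G k n = {e \<in> Mon. (\<forall>i. e i \<noteq> 0 \<longrightarrow> i \<in> G) \<and> vlen e = k \<and> dg e = n}"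

definition dimages :: "nat \<Rightarrow> mono set" where
  "dimages i = {b \<in> Mon. (\<forall>j. b j \<noteq> 0 \<longrightarrow> j \<in> Us) \<and> dg b = deg i + 1 \<and> 2 \<le> mlen N b}"

text \<open>The monomials \<open>e\<close> that may occur in \<open>D (mon m)\<close>: one generator of \<open>V\<close> in \<open>m\<close> is replaced by a
  monomial that may occur in its differential.\<close>
definition dstep :: "mono \<Rightarrow> mono \<Rightarrow> bool" where
  "dstep m e \<longleftrightarrow> (\<exists>i\<in>Vs. m i > 0 \<and> (\<exists>b\<in>dimages i. e = (\<lambda>j. dec i m j + b j) \<and>
     (\<forall>j. odd (deg j) \<longrightarrow> dec i m j = 0 \<or> b j = 0)))"

lemma Us_sub: "Us \<subseteq> {..<N}" and finite_Us: "finite Us" and finite_Vs: "finite Vs"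
  using stage finite_subset by (auto simp: two_stage_def Vs_def)

lemma Us_lt: "i \<in> Us \<Longrightarrow> i < N" and Vs_lt: "i \<in> Vs \<Longrightarrow> i < N"
  and Us_Vs: "Us \<inter> Vs = {}" "Us \<union> Vs = {..<N}"
  using Us_sub by (auto simp: Vs_def)

lemma deg_ge2: "i < N \<Longrightarrow> 2 \<le> deg i"
  using sull by (simp add: sullivan_alg_def)

lemma D_add: "f \<in> \<A> \<Longrightarrow> g \<in> \<A> \<Longrightarrow> D (f + g) = D f + D g"
  and D_scale: "f \<in> \<A> \<Longrightarrow> D (qscale c f) = qscale c (D f)"
  and D_D: "f \<in> \<A> \<Longrightarrow> D (D f) = 0"
  using sull by (auto simp: sullivan_alg_def elems_supported)

lemma D_homog: "homog N deg n f \<Longrightarrow> homog N deg (n + 1) (D f)"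
  and Leibniz: "homog N deg n a \<Longrightarrow> b \<in> \<A> \<Longrightarrow>
    D (amul deg a b) = amul deg (D a) b + qscale ((-1) ^ n) (amul deg a (D b))"
  using sull by (auto simp: sullivan_alg_def elems_supported)

lemma D_0 [simp]: "D 0 = 0"
  using D_scale[of 0 0] by simp

lemma D_diff: "f \<in> \<A> \<Longrightarrow> g \<in> \<A> \<Longrightarrow> D (f - g) = D f - D g"
  using D_add[of f "qscale (-1) g"] D_scale[of g "-1"] supported_qscale[of g Mon "-1"] by simp

lemma D_sum: "finite I \<Longrightarrow> (\<And>i. i \<in> I \<Longrightarrow> f i \<in> \<A>) \<Longrightarrow> D (sum f I) = (\<Sum>i\<in>I. D (f i))"
  by (induction I rule: finite_induct) (simp_all add: D_add supported_sum)

lemma dg_0 [simp]: "dg 0 = 0" and mlen_0 [simp]: "mlen N 0 = 0" and vlen_0 [simp]: "vlen 0 = 0"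
  by (simp_all add: mdeg_def mlen_def vlen_def)

lemma dg_ge_mlen: "2 * mlen N e \<le> dg e"
  unfolding mdeg_def mlen_def sum_distrib_left
  by (rule sum_mono) (use deg_ge2 in \<open>auto simp: mult.commute\<close>)

lemma mlen_eq_0: "e \<in> Mon \<Longrightarrow> mlen N e = 0 \<longleftrightarrow> e = 0"
  by (auto simp: mlen_def monoms_def fun_eq_iff) (metis lessThan_iff not_le)

lemma vlen_le_mlen: "vlen e \<le> mlen N e"
  unfolding vlen_def mlen_def by (rule sum_mono2) (auto simp: Vs_def)

lemma vlen_add: "vlen (\<lambda>j. a j + b j) = vlen a + vlen b"
  by (simp add: vlen_def sum.distrib)

lemma vlen_unit: "vlen (unit_mono i) = (if i \<in> Vs then 1 else 0)"
  unfolding vlen_def using sum_unit_mono[OF finite_Vs, of i "\<lambda>_. 1"] by simp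

lemma vlen_inc: "vlen (inc i m) = vlen m + (if i \<in> Vs then 1 else 0)"
  unfolding inc_eq_add vlen_add vlen_unit by simp

lemma inc_Mon: "m \<in> Mon \<Longrightarrow> i < N \<Longrightarrow> (odd (deg i) \<Longrightarrow> m i = 0) \<Longrightarrow> inc i m \<in> Mon"
  by (auto simp: monoms_def)

lemma unit_Mon: "i < N \<Longrightarrow> unit_mono i \<in> Mon"
  by (auto simp: monoms_def unit_mono_def)

lemma gen_A: "i < N \<Longrightarrow> gen i \<in> \<A>"
  by (simp add: gen_eq_mon unit_Mon)

lemma homog_gen: "i < N \<Longrightarrow> homog N deg (deg i) (gen i)"
  by (simp add: homog_iff gen_eq_mon unit_Mon mdeg_unit)

lemma homog_mon: "m \<in> Mon \<Longrightarrow> homog N deg (dg m) (mon m)"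
  by (simp add: homog_iff)

lemma D_gen_U: "i \<in> Us \<Longrightarrow> D (gen i) = 0"
  using stage by (auto simp: two_stage_def)

lemma D_gen_V: "i \<in> Vs \<Longrightarrow> D (gen i) \<in> supported (dimages i)"
proof -
  assume i: "i \<in> Vs"
  have h: "D (gen i) \<in> supported {e \<in> Mon. dg e = deg i + 1}"
    using D_homog[OF homog_gen[OF Vs_lt[OF i]]] by (simp add: homog_iff)
  have sV: "e j = 0" if "e \<in> esupp (D (gen i))" "j < N" "j \<notin> Us" for e j
    proof -
    have "\<forall>i<N. i \<notin> Us \<longrightarrow> (\<forall>e\<in>esupp (D (gen i)). \<forall>j<N. j \<notin> Us \<longrightarrow> e j = 0)"
      using stage unfolding two_stage_def by (elim conjE)
    moreover have "i < N" "i \<notin> Us" using i by (simp_all add: Vs_def)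
    ultimately show ?thesis using that by simp
  qed
  have u: "\<forall>j. e j \<noteq> 0 \<longrightarrow> j \<in> Us" if "e \<in> esupp (D (gen i))" for e
  proof (intro allI impI)
    fix j assume j: "e j \<noteq> 0"
    have "e \<in> Mon" using h that by (auto simp: supported_def)
    then have "j < N" using j by (rule monoms_out)
    then show "j \<in> Us" using sV[OF that, of j] j by auto
  qed
  have "\<forall>e\<in>esupp (D (gen i)). 2 \<le> mlen N e"
    using minim Vs_lt[OF i] by (auto simp: minimal_def)
  with h u show ?thesis by (auto simp: supported_def dimages_def)
qed

section \<open>The monomials that occur in a differential\<close>

lemma dimages_Mon: "dimages i \<subseteq> Mon"
  by (auto simp: dimages_def)

lemma D_gen_A: "i \<in> Vs \<Longrightarrow> D (gen i) \<in> \<A>"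
  using D_gen_V supported_mono[OF dimages_Mon] by blast

text \<open>The value has degree 1, and generators of degree at least 2 leave no monomial of that
  degree.\<close>

lemma D_mon_0: "D (mon 0) = 0"
proof -
  have "0 \<in> Mon" by (simp add: monoms_def)
  from D_homog[OF homog_mon[OF this]]
  have h: "D (mon 0) \<in> supported {e \<in> Mon. dg e = 1}" by (simp add: homog_iff)
  have "\<not> (e \<in> Mon \<and> dg e = 1)" for e
  proof
    assume e: "e \<in> Mon \<and> dg e = 1"
    then have "mlen N e = 0" using dg_ge_mlen[of e] by linarith
    then have "e = 0" using e mlen_eq_0[of e] by blast
    then have "dg e = 0" by (simp only: dg_0)
    then show False using e by linarith
  qed
  then have "{e \<in> Mon. dg e = 1} = {}" by blast
  then have "D (mon 0) \<in> {0}" using h by (simp only: supported_empty)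
  then show ?thesis by (rule singletonD)
qed

lemma mon_factor:
  assumes "m \<in> Mon" "m i > 0"
  obtains s where "mon m = amul deg (qscale s (mon (dec i m))) (gen i)"
proof
  let ?s = "msign deg (dec i m) (unit_mono i)"
  have o: "m i = 1" if "odd (deg i)"
    proof -
    have "m i \<le> 1" using assms(1) that by (simp add: monoms_def)
    then show ?thesis using assms(2) by simp
  qed
  show "mon m = amul deg (qscale ?s (mon (dec i m))) (gen i)"
  proof
    fix e
    have f: "finite (esupp (qscale ?s (mon (dec i m))))"
      by (rule finite_subset[OF esupp_qscale]) simp
    show "mon m e = amul deg (qscale ?s (mon (dec i m))) (gen i) e"
    proof (cases "e = m")
      case True
      have "\<not> (m i = 0 \<or> odd (deg i) \<and> m i \<noteq> 1)" using o assms(2) by auto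
      then show ?thesis
        unfolding amul_gen_cases[OF f] True by (simp add: qscale_apply mon_def)
    next
      case False
      show ?thesis
      proof (cases "e i = 0")
        case True
        then show ?thesis unfolding amul_gen_cases[OF f] using False by (simp add: mon_def)
      next
        case e: False
        have "dec i e \<noteq> dec i m"
        proof
          assume eq: "dec i e = dec i m"
          have "e = inc i (dec i e)" using e by (simp only: inc_dec neq0_conv)
          also have "\<dots> = inc i (dec i m)" by (simp only: eq)
          also have "\<dots> = m" using assms(2) by (rule inc_dec)
          finally show False using False by simp
        qed
        then have "qscale ?s (mon (dec i m)) (dec i e) = 0" by (simp only: qscale_apply mon_def) simp
        then show ?thesis unfolding amul_gen_cases[OF f] using False by (simp add: mon_def)
      qed
    qed
  qed
qed

text \<open>Induction on word length: \<open>m\<close> is, up to a scalar, a shorter monomial times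
  a last generator, and the Leibniz rule applies. Only the support is recorded, which makes the
  Koszul signs irrelevant.\<close>

lemma D_mon_esupp:
  "m \<in> Mon \<Longrightarrow> e \<in> esupp (D (mon m)) \<Longrightarrow> dstep m e"
proof (induction "mlen N m" arbitrary: m e)
  case 0
  then have "m = 0" using mlen_eq_0[OF 0(2)] by metis
  then have "esupp (D (mon m)) = {}" using D_mon_0 by (simp add: esupp_eq_empty)
  then show ?case using 0 by simp
next
  case (Suc l)
  have "\<exists>i. m i \<noteq> 0"
  proof (rule ccontr)
    assume "\<not> ?thesis"
    then show False using Suc(2) by (simp add: mlen_def)
  qed
  then obtain i where i: "m i > 0" by auto
  have iN: "i < N" using monoms_out[OF Suc.prems(1)] i by auto
  obtain s where s: "mon m = amul deg (qscale s (mon (dec i m))) (gen i)"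
    using mon_factor[OF Suc.prems(1) i] .
  have m'[intro, simp]: "dec i m \<in> Mon" using Suc.prems(1) by (rule dec_monoms)
  have id: "inc i (dec i m) = m" using i by (rule inc_dec)
  have l: "l = mlen N (dec i m)" using mlen_inc[OF iN, of "dec i m"] Suc(2) unfolding id by simp
  have o: "odd (deg j) \<Longrightarrow> m j \<le> 1" for j using Suc.prems(1) by (auto simp: monoms_def)
  let ?c = "qscale s (mon (dec i m))"
  have hc: "homog N deg (dg (dec i m)) ?c"
    using homog_mon[OF m'] by (auto simp: homog_iff intro: supported_qscale)
  have cA: "?c \<in> supported {dec i m}" by (intro supported_qscale) simp
  have D: "D (mon m) = amul deg (D ?c) (gen i) + qscale ((-1) ^ dg (dec i m)) (amul deg ?c (D (gen i)))"
    using Leibniz[OF hc gen_A[OF iN]] s by simp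
  have "D ?c \<in> supported {e. dstep (dec i m) e}"
  proof -
    have "D (mon (dec i m)) \<in> supported {e. dstep (dec i m) e}"
      using Suc(1)[OF l m'] D_homog[OF homog_mon[OF m']] by (auto simp: homog_iff supported_def)
    moreover have "D ?c = qscale s (D (mon (dec i m)))" using m' by (intro D_scale) simp
    ultimately show ?thesis by (simp only: supported_qscale)
  qed
  \<comment> \<open>A step from \<open>dec i m\<close> remains a step from \<open>m\<close> after
    multiplication by \<open>gen i\<close>. For odd \<open>i\<close> only terms without
    \<open>i\<close> survive, which gives the overlap condition at \<open>l = i\<close>.\<close>
  then have 1: "amul deg (D ?c) (gen i) \<in> supported {e. dstep m e}"
  proof (rule amul_gen_supported)
    fix a assume "a \<in> {e. dstep (dec i m) e}" and ai: "odd (deg i) \<Longrightarrow> a i = 0"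
    then obtain j b where j: "j \<in> Vs" "dec i m j > 0" "b \<in> dimages j"
      "a = (\<lambda>l. dec j (dec i m) l + b l)" "\<forall>l. odd (deg l) \<longrightarrow> dec j (dec i m) l = 0 \<or> b l = 0"
      by (auto simp: dstep_def)
    have "m j > 0" using j(2) by (cases "i = j") auto
    moreover have "inc i a = (\<lambda>l. dec j m l + b l)"
      using j(2) i by (auto simp: j(4) fun_eq_iff)
    moreover have "\<forall>l. odd (deg l) \<longrightarrow> dec j m l = 0 \<or> b l = 0"
    proof (intro allI impI)
      fix l assume l: "odd (deg l)"
      show "dec j m l = 0 \<or> b l = 0"
      proof (cases "l = i")
        case True
        then show ?thesis using ai l unfolding j(4) by auto
      next
        case False
        then show ?thesis using j(5)[rule_format, OF l] by (auto split: if_splits)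
      qed
    qed
    ultimately show "inc i a \<in> {e. dstep m e}" using j(1,3) unfolding dstep_def by blast
  qed
  have 2: "amul deg ?c (D (gen i)) \<in> supported {e. dstep m e}"
  proof (cases "i \<in> Us")
    case True
    then show ?thesis by (simp add: D_gen_U)
  next
    case False
    then have iV: "i \<in> Vs" using iN by (simp add: Vs_def)
    show ?thesis
    proof (rule amul_supported[OF cA D_gen_V[OF iV]])
      fix a b assume "a \<in> {dec i m}" "b \<in> dimages i" "\<forall>i. odd (deg i) \<longrightarrow> a i = 0 \<or> b i = 0"
      then show "(\<lambda>i. a i + b i) \<in> {e. dstep m e}"
        using iV i unfolding dstep_def by blast
    qed
  qed
  have "D (mon m) \<in> supported {e. dstep m e}"
    unfolding D using 1 2 by (intro supported_add supported_qscale)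
  then show ?case using Suc.prems(2) by (auto simp: supported_def)
qed

lemma D_supported:
  assumes "f \<in> supported S" "S \<subseteq> Mon" "\<And>m e. m \<in> S \<Longrightarrow> dstep m e \<Longrightarrow> e \<in> R"
  shows "D f \<in> supported R"
proof -
  have f: "f = (\<Sum>m\<in>esupp f. qscale (f m) (mon m))" "finite (esupp f)" "esupp f \<subseteq> S"
    using assms(1) expand_mon[of "esupp f" f] by (auto simp: supported_def)
  have "D f = D (\<Sum>m\<in>esupp f. qscale (f m) (mon m))" using f(1) by simp
  also have "\<dots> = (\<Sum>m\<in>esupp f. D (qscale (f m) (mon m)))"
    using f assms(2) by (intro D_sum supported_qscale) auto
  also have "\<dots> = (\<Sum>m\<in>esupp f. qscale (f m) (D (mon m)))"
    using f assms(2) by (intro sum.cong refl D_scale) auto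
  also have "\<dots> \<in> supported R"
  proof (intro supported_sum supported_qscale)
    fix m assume "m \<in> esupp f"
    then have m: "m \<in> S" "m \<in> Mon" using f assms(2) by auto
    have "finite (esupp (D (mon m)))"
      using D_homog[OF homog_mon[OF m(2)]] by (auto simp: homog_iff supported_def)
    then show "D (mon m) \<in> supported R"
      using D_mon_esupp[OF m(2)] assms(3)[OF m(1)] by (auto simp: supported_def)
  qed
  finally show ?thesis .
qed

lemma dg_dec: "i < N \<Longrightarrow> m i > 0 \<Longrightarrow> dg m = dg (dec i m) + deg i"
  using mdeg_inc[where i = i and m = "dec i m" and N = N and deg = deg] by (simp add: inc_dec)

lemma vlen_dec: "i \<in> Vs \<Longrightarrow> m i > 0 \<Longrightarrow> vlen m = vlen (dec i m) + 1"
  using vlen_inc[where i = i and m = "dec i m"] by (simp add: inc_dec)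

lemma dimages_vlen: "b \<in> dimages i \<Longrightarrow> vlen b = 0"
  unfolding vlen_def using Us_Vs(1) by (intro sum.neutral) (auto simp: dimages_def)

text \<open>Exponents on \<open>Us\<close> never decrease, which makes ideals generated by parts of
  \<open>U\<close> stable under \<open>D\<close>. Every term of a boundary has a factor in
  \<open>U\<close> and length at least 2, so it is neither 1 nor a single generator.\<close>

lemma dstep_props:
  assumes "dstep m e" "m \<in> Mon"
  shows "e \<in> Mon" "vlen m = vlen e + 1" "dg e = dg m + 1" "2 \<le> mlen N e"
    "u \<in> Us \<Longrightarrow> m u \<le> e u" "\<exists>u\<in>Us. e u > 0" "e j \<noteq> 0 \<Longrightarrow> j \<in> Us \<or> m j \<noteq> 0"
proof -
  obtain i b where i: "i \<in> Vs" "m i > 0" "b \<in> dimages i" "e = (\<lambda>j. dec i m j + b j)"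
    "\<And>j. odd (deg j) \<Longrightarrow> dec i m j = 0 \<or> b j = 0"
    using assms(1) unfolding dstep_def by blast
  have b: "b \<in> Mon" "\<And>j. b j \<noteq> 0 \<Longrightarrow> j \<in> Us" "dg b = deg i + 1" "2 \<le> mlen N b"
    using i(3) by (auto simp: dimages_def)
  have d: "dec i m \<in> Mon" using assms(2) by (rule dec_monoms)
  show "e \<in> Mon"
    unfolding monoms_def mem_Collect_eq
  proof (intro conjI allI impI)
    fix j assume "N \<le> j"
    then show "e j = 0" using d b(1) unfolding i(4) monoms_def by simp
  next
    fix j assume j: "odd (deg j)"
    have "dec i m j \<le> 1" "b j \<le> 1" using d b(1) j unfolding monoms_def by blast+
    then show "e j \<le> 1" using i(5)[OF j] unfolding i(4) by auto
  qed
  show "vlen m = vlen e + 1"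
    unfolding i(4) vlen_add using dimages_vlen[OF i(3)] vlen_dec[where i = i and m = m] i(1,2) by (simp del: fun_upd_apply)
  show "dg e = dg m + 1"
    unfolding i(4) mdeg_add using b(3) dg_dec[where i = i and m = m, OF Vs_lt[OF i(1)] i(2)] by (simp del: fun_upd_apply)
  show "2 \<le> mlen N e" unfolding i(4) mlen_add using b by simp
  show "u \<in> Us \<Longrightarrow> m u \<le> e u" using i(1) Us_Vs by (auto simp: i(4))
  have "\<exists>j. b j \<noteq> 0"
  proof (rule ccontr)
    assume "\<not> ?thesis"
    then have "mlen N b = 0" by (simp add: mlen_def)
    then show False using b(4) by linarith
  qed
  then obtain l where l: "b l \<noteq> 0" by blast
  then have "e l > 0" unfolding i(4) by simp
  then show "\<exists>u\<in>Us. e u > 0" using b(2)[OF l] by blast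
  show "j \<in> Us \<or> m j \<noteq> 0" if "e j \<noteq> 0"
  proof (rule ccontr)
    assume "\<not> ?thesis"
    then have "b j = 0" "m j = 0" using b(2)[of j] by blast+
    then show False using that unfolding i(4) by (simp split: if_splits)
  qed
qed

lemma D_in: "f \<in> \<A> \<Longrightarrow> D f \<in> \<A>"
  by (rule D_supported[of _ Mon]) (auto dest: dstep_props)

text \<open>The bidegree \<open>(k, n)\<close> piece of the subalgebra on the generators in
  \<open>G\<close>. Letting \<open>G\<close> vary allows the generators of \<open>V\<close> to be
  removed and put back one at a time.\<close>

definition K :: "nat set \<Rightarrow> nat \<Rightarrow> nat \<Rightarrow> elem set" where
  "K G k n = supported (basis G k n)"

lemma basis_Mon: "basis G k n \<subseteq> Mon" by (auto simp: basis_def)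

lemma K_A: "f \<in> K G k n \<Longrightarrow> f \<in> \<A>"
  using supported_mono[OF basis_Mon] by (auto simp: K_def)

lemma K_homog: "f \<in> K G k n \<Longrightarrow> homog N deg n f"
proof -
  assume "f \<in> K G k n"
  moreover have "basis G k n \<subseteq> {e \<in> Mon. dg e = n}" by (auto simp: basis_def)
  ultimately show ?thesis unfolding K_def homog_iff using supported_mono by blast
qed

lemma K_mono: "G \<subseteq> G' \<Longrightarrow> K G k n \<subseteq> K G' k n"
  unfolding K_def by (rule supported_mono) (auto simp: basis_def)

lemma D_K_Suc: "f \<in> K G (Suc k) n \<Longrightarrow> Us \<subseteq> G \<Longrightarrow> D f \<in> K G k (Suc n)"
  unfolding K_def
proof (rule D_supported)
  fix m e assume a: "Us \<subseteq> G" "m \<in> basis G (Suc k) n" "dstep m e"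
  then have "m \<in> Mon" by (auto simp: basis_def)
  from dstep_props[OF a(3) this] a show "e \<in> basis G k (Suc n)"
    by (auto simp: basis_def)
qed (auto simp: basis_def)

lemma D_K_0: "f \<in> K G 0 n \<Longrightarrow> D f = 0"
proof -
  assume "f \<in> K G 0 n"
  then have "D f \<in> supported {}"
    unfolding K_def by (rule D_supported) (auto simp: basis_def dest: dstep_props)
  then show ?thesis by (simp add: supported_empty)
qed

lemma D_K: "f \<in> K G k n \<Longrightarrow> Us \<subseteq> G \<Longrightarrow> D f \<in> K G (k - 1) (Suc n)"
  by (cases k) (use D_K_Suc D_K_0 in \<open>auto simp: K_def\<close>)

text \<open>As generators have degree at least 2, the degree bounds every exponent.\<close>

lemma finite_basis: "finite (basis G k n)"
proof (rule finite_subset)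
  show "basis G k n \<subseteq> {e. \<forall>i. (i \<in> {..<N} \<longrightarrow> e i \<in> {..n}) \<and> (i \<notin> {..<N} \<longrightarrow> e i = 0)}"
  proof
    fix e assume e: "e \<in> basis G k n"
    have "e i \<le> n" if "i < N" for i
    proof -
      have "e i \<le> mlen N e" unfolding mlen_def using that by (intro member_le_sum) auto
      then show ?thesis using e dg_ge_mlen[of e] by (auto simp: basis_def)
    qed
    then show "e \<in> {e. \<forall>i. (i \<in> {..<N} \<longrightarrow> e i \<in> {..n}) \<and> (i \<notin> {..<N} \<longrightarrow> e i = 0)}"
      using e by (auto simp: basis_def monoms_def)
  qed
qed (rule finite_set_of_finite_funs, auto)

lemma K_subspace: "Q.subspace (K G k n)"
  unfolding K_def by (rule subspace_supported)

end

section \<open>Rigidity of the cohomology\<close>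

lemma amul_gen_eq_0:
  assumes "c \<in> supported S" "\<And>m. m \<in> S \<Longrightarrow> odd (deg i) \<Longrightarrow> m i = 0" "amul deg c (gen i) = 0"
  shows "c = 0"
proof (rule ccontr)
  assume "c \<noteq> 0"
  then obtain m where m: "m \<in> esupp c" by (auto simp: esupp_eq_empty[symmetric])
  have "inc i m \<in> esupp (amul deg c (gen i))"
    by (rule esupp_amul_gen_inc) (use assms(1,2) m in \<open>auto simp: supported_def\<close>)
  then show False using assms(3) by simp
qed

lemma supported_disjoint_sum:
  assumes "x \<in> supported S" "y \<in> supported T" "S \<inter> T = {}" "x + y = 0"
  shows "x = 0" "y = 0"
proof -
  have "x = - y" using assms(4) by (simp add: eq_neg_iff_add_eq_0)
  then have "esupp x = esupp y" by (auto simp: esupp_def)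
  then have "esupp x = {}" using assms(1-3) by (auto simp: supported_def)
  then show "x = 0" by (simp add: esupp_eq_empty)
  then show "y = 0" using assms(4) by simp
qed

lemma amul_gen_diff:
  assumes "finite (esupp c)" "finite (esupp c')"
  shows "amul deg (c - c') (gen i) = amul deg c (gen i) - amul deg c' (gen i)"
proof -
  have "finite (esupp (c - c'))" using assms esupp_diff finite_subset by blast
  from amul_gen_add[OF this assms(2), of deg i] show ?thesis by simp
qed

context two_stage_sullivan
begin

lemma K_finite: "f \<in> K G k n \<Longrightarrow> finite (esupp f)"
  by (simp add: K_def supported_def)

lemma K_0 [simp]: "0 \<in> K G k n"
  by (simp add: K_def)

lemma K_add: "f \<in> K G k n \<Longrightarrow> g \<in> K G k n \<Longrightarrow> f + g \<in> K G k n"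
  and K_diff: "f \<in> K G k n \<Longrightarrow> g \<in> K G k n \<Longrightarrow> f - g \<in> K G k n"
  and K_qscale: "f \<in> K G k n \<Longrightarrow> qscale c f \<in> K G k n"
  by (simp_all add: K_def supported_add supported_diff supported_qscale)

text \<open>Each of the \<open>k\<close> factors in \<open>V\<close> has degree at least 2. For
  \<open>k \<ge> 1\<close> this excludes the small degrees in which \<open>n - 1\<close> would be
  truncated.\<close>

lemma K_nonzero: "f \<in> K G k n \<Longrightarrow> f \<noteq> 0 \<Longrightarrow> 2 * k \<le> n"
proof -
  assume "f \<in> K G k n" "f \<noteq> 0"
  then obtain e where "e \<in> basis G k n"
    by (auto simp: K_def supported_def esupp_eq_empty[symmetric])
  then show ?thesis using dg_ge_mlen[of e] vlen_le_mlen[of e] by (auto simp: basis_def)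
qed

lemma amul_gen_K:
  assumes "c \<in> K G k p" "i < N"
  shows "amul deg c (gen i) \<in> K (insert i G) (k + (if i \<in> Vs then 1 else 0)) (p + deg i)"
  using assms(1) unfolding K_def
proof (rule amul_gen_supported)
  fix a assume a: "a \<in> basis G k p" "odd (deg i) \<Longrightarrow> a i = 0"
  have "inc i a \<in> Mon" using a assms(2) by (intro inc_Mon) (auto simp: basis_def)
  moreover have "vlen (inc i a) = k + (if i \<in> Vs then 1 else 0)"
    unfolding vlen_inc using a(1) by (simp add: basis_def)
  moreover have "dg (inc i a) = p + deg i"
    unfolding mdeg_inc[OF assms(2)] using a(1) by (simp add: basis_def)
  ultimately show "inc i a \<in> basis (insert i G) (k + (if i \<in> Vs then 1 else 0)) (p + deg i)"
    using a(1) by (simp add: basis_def)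
qed

lemma amul_gen_U_K:
  assumes "c \<in> K G k p" "u \<in> Us" "Us \<subseteq> G"
  shows "amul deg c (gen u) \<in> K G k (p + deg u)"
proof -
  have "u \<notin> Vs" "u < N" "insert u G = G" using assms Us_Vs Us_lt by auto
  then show ?thesis using amul_gen_K[OF assms(1), of u] by simp
qed

lemma amul_gen_V_K:
  assumes "c \<in> K G k p" "v \<in> Vs"
  shows "amul deg c (gen v) \<in> K (insert v G) (Suc k) (p + deg v)"
  using amul_gen_K[OF assms(1) Vs_lt[OF assms(2)]] assms(2) by simp

lemma add_Mon:
  assumes "a \<in> Mon" "b \<in> Mon" "\<forall>i. odd (deg i) \<longrightarrow> a i = 0 \<or> b i = 0"
  shows "(\<lambda>i. a i + b i) \<in> Mon"
  unfolding monoms_def mem_Collect_eq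
proof (intro conjI allI impI)
  fix j assume "N \<le> j"
  then show "a j + b j = 0" using assms(1,2) by (simp add: monoms_def)
next
  fix j assume j: "odd (deg j)"
  have "a j \<le> 1" "b j \<le> 1" using assms(1,2) j by (simp_all add: monoms_def)
  then show "a j + b j \<le> 1" using assms(3) j by auto
qed

lemma amul_D_gen_K:
  assumes "c \<in> K G k p" "v \<in> Vs" "Us \<subseteq> G"
  shows "amul deg c (D (gen v)) \<in> K G k (p + deg v + 1)"
  unfolding K_def
proof (rule amul_supported[OF assms(1)[unfolded K_def] D_gen_V[OF assms(2)]])
  fix a b assume a: "a \<in> basis G k p" and b: "b \<in> dimages v"
    and ab: "\<forall>i. odd (deg i) \<longrightarrow> a i = 0 \<or> b i = 0"
  have "(\<lambda>i. a i + b i) \<in> Mon"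
    using a b ab by (intro add_Mon) (auto simp: basis_def dimages_def)
  moreover have "dg (\<lambda>i. a i + b i) = p + deg v + 1"
    using a b by (simp add: mdeg_add basis_def dimages_def)
  moreover have "vlen (\<lambda>i. a i + b i) = k"
    using a dimages_vlen[OF b] by (simp add: vlen_add basis_def)
  moreover have "\<forall>i. a i + b i \<noteq> 0 \<longrightarrow> i \<in> G"
    using a b assms(3) by (auto simp: basis_def dimages_def)
  ultimately show "(\<lambda>i. a i + b i) \<in> basis G k (p + deg v + 1)"
    by (simp add: basis_def)
qed

lemma Leibniz_gen:
  assumes "c \<in> K G k p" "i < N"
  shows "D (amul deg c (gen i)) = amul deg (D c) (gen i) + qscale ((-1) ^ p) (amul deg c (D (gen i)))"
  using Leibniz[OF K_homog[OF assms(1)] gen_A[OF assms(2)]] .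

lemma Leibniz_U:
  assumes "c \<in> K G k p" "u \<in> Us"
  shows "D (amul deg c (gen u)) = amul deg (D c) (gen u)"
  using Leibniz_gen[OF assms(1) Us_lt[OF assms(2)]] D_gen_U[OF assms(2)] by simp

lemma Leibniz_D:
  assumes "c \<in> K G k p" "v \<in> Vs"
  shows "D (amul deg c (D (gen v))) = amul deg (D c) (D (gen v))"
  using Leibniz[OF K_homog[OF assms(1)] D_gen_A[OF assms(2)]] D_D[OF gen_A[OF Vs_lt[OF assms(2)]]]
  by simp

text \<open>An odd \<open>v\<close> occurs at most once in a monomial: the terms without it form
  \<open>b'\<close>, and the others are divided by it from the right. The clause on
  \<open>c \<noteq> 0\<close> ensures that \<open>m - deg v\<close> is a true difference whenever it
  matters.\<close>

lemma split_gen: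
  assumes "b \<in> K (insert v G) (Suc k) m" "v \<in> Vs" "odd (deg v)"
  obtains b' c where "b' \<in> K G (Suc k) m" "c \<in> K G k (m - deg v)" "c \<noteq> 0 \<Longrightarrow> deg v \<le> m"
    "b = b' + amul deg c (gen v)"
proof
  let ?b' = "proj {e. e v = 0} b" and ?b'' = "proj (- {e. e v = 0}) b"
  let ?c = "rdiv deg v ?b''"
  let ?S = "basis (insert v G) (Suc k) m \<inter> - {e. e v = 0}"
  have b'': "?b'' \<in> supported ?S" using assms(1) by (simp add: K_def supported_proj)
  have "?b' \<in> supported (basis (insert v G) (Suc k) m \<inter> {e. e v = 0})"
    using assms(1) by (simp add: K_def supported_proj)
  moreover have "basis (insert v G) (Suc k) m \<inter> {e. e v = 0} \<subseteq> basis G (Suc k) m"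
    unfolding basis_def by fastforce
  ultimately show "?b' \<in> K G (Suc k) m" unfolding K_def using supported_mono by blast
  have "amul deg ?c (gen v) = ?b''"
  proof (rule amul_rdiv[OF b''])
    fix e assume "e \<in> ?S"
    then have "e \<in> Mon" "e v > 0" by (auto simp: basis_def)
    then show "e v > 0 \<and> (odd (deg v) \<longrightarrow> e v = 1)" by (auto simp: monoms_def intro: le_antisym)
  qed
  then show "b = ?b' + amul deg ?c (gen v)" using proj_split[of b "{e. e v = 0}"] by simp
  have key: "e \<in> basis G k (m - deg v) \<and> deg v \<le> m" if e: "inc v e \<in> ?S" "odd (deg v) \<Longrightarrow> e v = 0" for e
  proof -
    have ev: "e v = 0" using e(2) assms(3) by simp
    have M: "inc v e \<in> Mon" using e(1) by (simp add: basis_def)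
    have "dec v (inc v e) = e" by auto
    then have "e \<in> Mon" using dec_monoms[OF M, of v] by (simp only:)
    moreover have "vlen e = k" using e(1) assms(2) vlen_inc[where i = v and m = e] by (simp add: basis_def del: fun_upd_apply)
    moreover have "dg e + deg v = m"
      using e(1) mdeg_inc[OF Vs_lt[OF assms(2)], of deg e] by (simp add: basis_def del: fun_upd_apply)
    moreover have "\<forall>i. e i \<noteq> 0 \<longrightarrow> i \<in> G"
    proof (intro allI impI)
      fix i assume i: "e i \<noteq> 0"
      then have "i \<noteq> v" using ev by auto
      then have "inc v e i \<noteq> 0" using i by simp
      then have "i \<in> insert v G" using e(1) unfolding basis_def by blast
      then show "i \<in> G" using \<open>i \<noteq> v\<close> by simp
    qed
    ultimately show ?thesis by (auto simp: basis_def)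
  qed
  show "?c \<in> K G k (m - deg v)"
    unfolding K_def by (rule rdiv_supported[OF b'']) (use key in blast)
  have "?c \<in> supported {e. deg v \<le> m}"
    by (rule rdiv_supported[OF b'']) (use key in blast)
  then show "deg v \<le> m" if "?c \<noteq> 0"
    using that by (cases "deg v \<le> m") (simp_all add: supported_empty)
qed

section \<open>Exactness with and without one generator of V\<close>

lemma K_avoid: "c \<in> K G k p \<Longrightarrow> v \<notin> G \<Longrightarrow> c \<in> supported {e. e v = 0}"
  unfolding K_def using supported_mono[of "basis G k p" "{e. e v = 0}"] by (auto simp: basis_def)

lemma amul_gen_hit: "c \<in> supported S \<Longrightarrow> amul deg c (gen v) \<in> supported {e. e v \<noteq> 0}"
  by (rule amul_gen_supported) auto

text \<open>The truncation in \<open>n - 1\<close> is harmless: \<open>K G k 0 = {0}\<close> for \<open>k \<ge> 1\<close>.\<close>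
definition exact_on :: "nat set \<Rightarrow> nat \<Rightarrow> bool" where
  "exact_on G k \<longleftrightarrow> (\<forall>n. \<forall>a\<in>K G k n. D a = 0 \<longrightarrow> (\<exists>b\<in>K G (Suc k) (n - 1). D b = a))"

text \<open>By the Leibniz rule \<open>(D c) v\<close> is the only part of the differential whose
  terms contain \<open>v\<close>. The total lies in a piece without \<open>v\<close>, so this part
  vanishes, and multiplication by \<open>v\<close> is injective on elements free of
  \<open>v\<close>.\<close>

lemma cocycle_split:
  assumes "a \<in> K G (Suc k) n" "c \<in> K G k p" "v \<in> Vs" "odd (deg v)" "v \<notin> G" "Us \<subseteq> G"
    and "D (a + amul deg c (gen v)) \<in> K G k (Suc n)" "c \<noteq> 0 \<Longrightarrow> p + deg v = n"
  shows "D c = 0" "D (a + amul deg c (gen v)) = D a + qscale ((-1) ^ p) (amul deg c (D (gen v)))"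
proof -
  let ?s = "qscale ((-1) ^ p) (amul deg c (D (gen v)))"
  let ?w = "D (a + amul deg c (gen v))"
  have "D (a + amul deg c (gen v)) = D a + D (amul deg c (gen v))"
    using K_A[OF assms(1)] K_A[OF amul_gen_V_K[OF assms(2,3)]] by (rule D_add)
  also have "\<dots> = D a + (amul deg (D c) (gen v) + ?s)"
    using Leibniz_gen[OF assms(2) Vs_lt[OF assms(3)]] by simp
  finally have w: "?w = D a + (amul deg (D c) (gen v) + ?s)" .
  have av: "D a \<in> supported {e. e v = 0}" "?s \<in> supported {e. e v = 0}" "?w \<in> supported {e. e v = 0}"
    "D c \<in> supported {e. e v = 0}"
    using K_avoid[OF D_K[OF assms(1,6)] assms(5)] K_avoid[OF K_qscale[OF amul_D_gen_K[OF assms(2,3,6)]] assms(5)]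
      K_avoid[OF assms(7,5)] K_avoid[OF D_K[OF assms(2,6)] assms(5)] by auto
  have s: "(D a + ?s - ?w) + amul deg (D c) (gen v) = 0" using w by simp
  have "D a + ?s - ?w \<in> supported {e. e v = 0}"
    using av by (intro supported_diff supported_add)
  moreover have "amul deg (D c) (gen v) \<in> supported {e. e v \<noteq> 0}" by (rule amul_gen_hit[OF av(4)])
  ultimately have z: "amul deg (D c) (gen v) = 0"
    by (rule supported_disjoint_sum(2)[OF _ _ _ s]) auto
  then show "D c = 0" by (intro amul_gen_eq_0[OF av(4)]) auto
  show "?w = D a + ?s" using w z by simp
qed

text \<open>Nakayama's lemma for the exact sequence relating the complexes with and without \<open>v\<close>;
  it needs only that \<open>D (gen v)\<close> has positive degree.\<close>
lemma exact_on_remove: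
  assumes ex: "exact_on (insert v G) k" and k: "1 \<le> k"
    and v: "v \<in> Vs" "odd (deg v)" "v \<notin> G" "Us \<subseteq> G"
  shows "exact_on G k"
proof -
  have "\<forall>a\<in>K G k n. D a = 0 \<longrightarrow> (\<exists>b\<in>K G (Suc k) (n - 1). D b = a)" for n
  proof (induction n rule: less_induct)
    case (less n)
    show ?case
    proof (intro ballI impI)
      fix a assume a: "a \<in> K G k n" "D a = 0"
      show "\<exists>b\<in>K G (Suc k) (n - 1). D b = a"
      proof (cases "a = 0")
        case True
        then show ?thesis by (intro bexI[of _ 0]) auto
      next
        case False
        then have n: "2 \<le> n" using K_nonzero[OF a(1)] k by simp
        have "a \<in> K (insert v G) k n" using a(1) K_mono[of G "insert v G"] by auto
        then obtain b' where b': "b' \<in> K (insert v G) (Suc k) (n - 1)" "D b' = a"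
          using ex a(2) unfolding exact_on_def by blast
        obtain b c where bc: "b \<in> K G (Suc k) (n - 1)" "c \<in> K G k (n - 1 - deg v)"
          "c \<noteq> 0 \<Longrightarrow> deg v \<le> n - 1" "b' = b + amul deg c (gen v)"
          using split_gen[OF b'(1) v(1,2)] by metis
        let ?p = "n - 1 - deg v"
        have "D (b + amul deg c (gen v)) \<in> K G k (Suc (n - 1))"
          using a(1) b'(2) bc(4) n by simp
        moreover have "?p + deg v = n - 1" if "c \<noteq> 0" using bc(3)[OF that] by simp
        ultimately have sp: "D c = 0 \<and>
          D (b + amul deg c (gen v)) = D b + qscale ((-1) ^ ?p) (amul deg c (D (gen v)))"
          by (intro conjI cocycle_split[OF bc(1,2) v])
        then have Dc: "D c = 0" by simp
        have "D (b + amul deg c (gen v)) = D b + qscale ((-1) ^ ?p) (amul deg c (D (gen v)))"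
          using sp by (rule conjunct2)
        then have a_eq: "a = D b + qscale ((-1) ^ ?p) (amul deg c (D (gen v)))"
          using bc(4) b'(2) by simp
        show ?thesis
        proof (cases "c = 0")
          case True
          then show ?thesis using a_eq bc(1) by auto
        next
          case False
          then have p: "2 \<le> ?p" using K_nonzero[OF bc(2)] k by simp
          then have "?p < n" by simp
          \<comment> \<open>\<open>c\<close> is a cocycle of smaller degree, so the induction
            hypothesis gives \<open>c = D e\<close>. Since \<open>D (D v) = 0\<close>, the term
            \<open>c (D v)\<close> equals \<open>D (e (D v))\<close> and can be absorbed into
            \<open>b\<close>.\<close>
          then obtain e where e: "e \<in> K G (Suc k) (?p - 1)" "D e = c"
            using less.IH bc(2) Dc by blast
          have "amul deg e (D (gen v)) \<in> K G (Suc k) (?p - 1 + deg v + 1)"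
            by (rule amul_D_gen_K[OF e(1) v(1,4)])
          moreover have "?p - 1 + deg v + 1 = n - 1" using p by simp
          ultimately have eK: "amul deg e (D (gen v)) \<in> K G (Suc k) (n - 1)" by (simp only:)
          let ?q = "qscale ((-1) ^ ?p) (amul deg e (D (gen v)))"
          have "D (b + ?q) = D b + qscale ((-1) ^ ?p) (D (amul deg e (D (gen v))))"
            using D_add[OF K_A[OF bc(1)] K_A[OF K_qscale[OF eK]]] D_scale[OF K_A[OF eK]] by simp
          also have "\<dots> = a" using a_eq Leibniz_D[OF e(1) v(1)] e(2) by simp
          finally show ?thesis using K_add[OF bc(1) K_qscale[OF eK]] by blast
        qed
      qed
    qed
  qed
  then show ?thesis unfolding exact_on_def by blast
qed

text \<open>The other half of the exact sequence. In a cocycle \<open>a + c v\<close> the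
  coefficient \<open>c\<close> is a cocycle over \<open>G\<close>. If \<open>c = D e\<close>,
  subtracting the boundary \<open>D (e v)\<close> removes all terms with \<open>v\<close>, and what
  remains is exact over \<open>G\<close>.\<close>

lemma exact_on_insert:
  assumes ex: "exact_on G k" "exact_on G (Suc k)" and k: "1 \<le> k"
    and v: "v \<in> Vs" "odd (deg v)" "v \<notin> G" "Us \<subseteq> G"
  shows "exact_on (insert v G) (Suc k)"
  unfolding exact_on_def
proof (intro allI ballI impI)
  fix n a' assume a': "a' \<in> K (insert v G) (Suc k) n" "D a' = 0"
  obtain a c where ac: "a \<in> K G (Suc k) n" "c \<in> K G k (n - deg v)"
    "c \<noteq> 0 \<Longrightarrow> deg v \<le> n" "a' = a + amul deg c (gen v)"
    using split_gen[OF a'(1) v(1,2)] by metis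
  let ?p = "n - deg v"
  have "D (a + amul deg c (gen v)) \<in> K G k (Suc n)" using a'(2) ac(4) by simp
  moreover have "?p + deg v = n" if "c \<noteq> 0" using ac(3)[OF that] by simp
  ultimately have Dc: "D c = 0" by (rule cocycle_split(1)[OF ac(1,2) v])
  \<comment> \<open>Choosing \<open>e = 0\<close> for \<open>c = 0\<close> makes the correction
    terms vanish in the case where \<open>?p\<close> and \<open>?p - 1\<close> may be
    truncated.\<close>
  obtain e where e: "e \<in> K G (Suc k) (?p - 1)" "D e = c" "c = 0 \<Longrightarrow> e = 0"
  proof (cases "c = 0")
    case True
    then show ?thesis using that[of 0] by simp
  next
    case False
    then show ?thesis using that ex(1) ac(2) Dc unfolding exact_on_def by blast
  qed
  have p: "2 \<le> ?p" if "c \<noteq> 0" using K_nonzero[OF ac(2) that] k by simp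
  \<comment> \<open>The exponent \<open>?p - 1\<close> of the sign is the degree of
    \<open>e\<close>.\<close>
  let ?t = "qscale ((-1) ^ (?p - 1)) (amul deg e (D (gen v)))"
  have tK: "?t \<in> K G (Suc k) n"
  proof (cases "c = 0")
    case False
    have "?p - 1 + deg v + 1 = n" using p[OF False] by simp
    then show ?thesis using K_qscale[OF amul_D_gen_K[OF e(1) v(1,4)]] by simp
  qed (use e(3) in simp)
  have evK: "amul deg e (gen v) \<in> K (insert v G) (Suc (Suc k)) (n - 1)"
  proof (cases "c = 0")
    case False
    have "?p - 1 + deg v = n - 1" using p[OF False] by simp
    then show ?thesis using amul_gen_V_K[OF e(1) v(1)] by simp
  qed (use e(3) in simp)
  have Dev: "D (amul deg e (gen v)) = amul deg c (gen v) + ?t"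
    using Leibniz_gen[OF e(1) Vs_lt[OF v(1)]] e(2) by simp
  have a_t: "a - ?t = a' - D (amul deg e (gen v))" using Dev ac(4) by simp
  have "D (a - ?t) = D a' - D (D (amul deg e (gen v)))"
    unfolding a_t by (rule D_diff[OF K_A[OF a'(1)] D_in[OF K_A[OF evK]]])
  also have "\<dots> = 0" using a'(2) D_D[OF K_A[OF evK]] by simp
  finally obtain b where b: "b \<in> K G (Suc (Suc k)) (n - 1)" "D b = a - ?t"
    using ex(2) K_diff[OF ac(1) tK] unfolding exact_on_def by blast
  have bK: "b \<in> K (insert v G) (Suc (Suc k)) (n - 1)" using b(1) K_mono[of G "insert v G"] by auto
  have "D (b + amul deg e (gen v)) = a'"
    using D_add[OF K_A[OF bK] K_A[OF evK]] b(2) a_t by simp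
  then show "\<exists>b\<in>K (insert v G) (Suc (Suc k)) (n - 1). D b = a'"
    using K_add[OF bK evK] by blast
qed

lemma exact_on_subset:
  assumes "exact_on {..<N} k" "1 \<le> k" "\<And>v. v \<in> Vs \<Longrightarrow> odd (deg v)" "F \<subseteq> Vs"
  shows "exact_on (Us \<union> F) k"
proof -
  have "exact_on (Us \<union> (Vs - F)) k" if "F \<subseteq> Vs" for F
    using finite_subset[OF that finite_Vs] that
  proof (induction F rule: finite_induct)
    case empty
    then show ?case using assms(1) Us_Vs by simp
  next
    case (insert v F)
    then have "insert v (Us \<union> (Vs - insert v F)) = Us \<union> (Vs - F)" by auto
    then have e: "exact_on (insert v (Us \<union> (Vs - insert v F))) k" using insert by simp
    show ?case
      by (rule exact_on_remove[OF e assms(2)]) (use insert.prems assms(3) Us_Vs in auto)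
  qed
  from this[of "Vs - F"] show ?thesis using assms(4) by (simp add: double_diff)
qed

text \<open>Rigidity. Without \<open>V\<close> there is nothing of V-length \<open>Suc k\<close>, so
  exactness there is trivial. It survives adding the generators of \<open>V\<close> one at a time,
  because \<open>exact_on_subset\<close> supplies exactness at \<open>k\<close> for each
  intermediate set.\<close>

lemma exact_on_Suc:
  assumes "exact_on {..<N} k" "1 \<le> k" "\<And>v. v \<in> Vs \<Longrightarrow> odd (deg v)"
  shows "exact_on {..<N} (Suc k)"
proof -
  have "exact_on (Us \<union> F) (Suc k)" if "F \<subseteq> Vs" for F
    using finite_subset[OF that finite_Vs] that
  proof (induction F rule: finite_induct)
    case empty
    have "basis Us (Suc k) n = {}" for n
    proof -
      have "vlen e = 0" if "\<forall>i. e i \<noteq> 0 \<longrightarrow> i \<in> Us" for e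
        unfolding vlen_def using that Us_Vs(1) by (intro sum.neutral) auto
      then show ?thesis unfolding basis_def by fastforce
    qed
    then show ?case by (auto simp: exact_on_def K_def supported_empty intro!: bexI[of _ 0])
  next
    case (insert v F)
    have "exact_on (Us \<union> F) k" using exact_on_subset[OF assms] insert.prems by simp
    moreover have "exact_on (Us \<union> F) (Suc k)" using insert by simp
    ultimately have "exact_on (insert v (Us \<union> F)) (Suc k)"
      by (rule exact_on_insert) (use assms(2,3) insert Us_Vs in auto)
    then show ?case by simp
  qed
  from this[of Vs] show ?thesis using Us_Vs by simp
qed

lemma exact_on_ge:
  assumes "exact_on {..<N} k" "1 \<le> k" "\<And>v. v \<in> Vs \<Longrightarrow> odd (deg v)" "k \<le> k'"
  shows "exact_on {..<N} k'"
  using assms(4)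
proof (induction k' rule: dec_induct)
  case (step m)
  then show ?case using exact_on_Suc[of m] assms(2,3) by simp
qed (rule assms(1))

section \<open>Quotients by generators of U\<close>

text \<open>Within \<open>\<A>\<close>, \<open>supported (hit S)\<close> is the ideal generated by
  the generators in \<open>S\<close>.\<close>

definition hit :: "nat set \<Rightarrow> mono set" where
  "hit S = {e. \<exists>u\<in>S. e u \<noteq> 0}"

text \<open>Vanishing of the cohomology of the quotient by the ideal generated by \<open>S\<close>, phrased by
  congruences modulo \<open>supported (hit S)\<close>.\<close>
definition qexact :: "nat set \<Rightarrow> nat \<Rightarrow> nat \<Rightarrow> bool" where
  "qexact S k n \<longleftrightarrow> (\<forall>a\<in>K {..<N} k n. D a \<in> supported (hit S) \<longrightarrow>
     (\<exists>c\<in>K {..<N} (Suc k) (n - 1). a - D c \<in> supported (hit S)))"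

lemma hit_empty: "hit {} = {}"
  by (simp add: hit_def)

lemma exact_on_qexact: "exact_on {..<N} k \<Longrightarrow> qexact {} k n"
  unfolding exact_on_def qexact_def hit_empty supported_empty by force

lemma D_hit:
  assumes "f \<in> \<A>" "f \<in> supported (hit S)" "S \<subseteq> Us"
  shows "D f \<in> supported (hit S)"
proof (rule D_supported)
  show "f \<in> supported (Mon \<inter> hit S)" using assms(1,2) by (auto simp flip: supported_Int)
  fix m e assume m: "m \<in> Mon \<inter> hit S" and de: "dstep m e"
  then obtain u where u: "u \<in> S" "m u \<noteq> 0" by (auto simp: hit_def)
  then have "m u \<le> e u" using dstep_props(5)[OF de, of u] m assms(3) by auto
  then have "e u \<noteq> 0" using u(2) by linarith
  then show "e \<in> hit S" using u(1) unfolding hit_def by blast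
qed auto

text \<open>Once the terms in the ideal of \<open>S\<close> are projected away, every remaining
  monomial contains \<open>u\<close> and can be divided by it. The quotient is reduced modulo
  \<open>S\<close> and, for odd \<open>u\<close>, free of \<open>u\<close>.\<close>

lemma quotient_split:
  assumes w: "w \<in> K {..<N} k n" and wS: "w \<in> supported (hit (insert u S))" and u: "u \<in> Us"
  obtains v where "v \<in> K {..<N} k (n - deg u)" "v \<noteq> 0 \<Longrightarrow> deg u \<le> n"
    "v \<in> supported (- hit S)" "w = proj (hit S) w + amul deg v (gen u)"
    "\<And>m. m \<in> esupp v \<Longrightarrow> odd (deg u) \<Longrightarrow> m u = 0"
proof
  let ?w = "proj (- hit S) w"
  let ?v = "rdiv deg u ?w"
  let ?S = "basis {..<N} k n \<inter> hit {u} \<inter> - hit S"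
  have uN: "u < N" "u \<notin> Vs" using u Us_lt Us_Vs by auto
  have "w \<in> supported (basis {..<N} k n \<inter> hit (insert u S))"
    using w wS by (simp add: K_def flip: supported_Int)
  then have "?w \<in> supported (basis {..<N} k n \<inter> hit (insert u S) \<inter> - hit S)"
    by (rule supported_proj)
  then have w': "?w \<in> supported ?S"
    using supported_mono[of "basis {..<N} k n \<inter> hit (insert u S) \<inter> - hit S" ?S]
    by (auto simp: hit_def)
  have "amul deg ?v (gen u) = ?w"
  proof (rule amul_rdiv[OF w'])
    fix e assume "e \<in> ?S"
    then have "e \<in> Mon" "e u > 0" by (auto simp: basis_def hit_def)
    then show "e u > 0 \<and> (odd (deg u) \<longrightarrow> e u = 1)" by (auto simp: monoms_def intro: le_antisym)
  qed
  then show "w = proj (hit S) w + amul deg ?v (gen u)" using proj_split[of w "hit S"] by simp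
  have key: "e \<in> basis {..<N} k (n - deg u) \<and> deg u \<le> n \<and> e \<in> - hit S"
    if e: "inc u e \<in> ?S" for e
  proof -
    have M: "inc u e \<in> Mon" using e by (simp add: basis_def)
    have "dec u (inc u e) = e" by auto
    then have eM: "e \<in> Mon" using dec_monoms[OF M, of u] by (simp only:)
    moreover have "vlen e = k" using e uN vlen_inc[where i = u and m = e] by (simp add: basis_def del: fun_upd_apply)
    moreover have "dg e + deg u = n"
      using e mdeg_inc[OF uN(1), of deg e] by (simp add: basis_def del: fun_upd_apply)
    moreover have "\<forall>i. e i \<noteq> 0 \<longrightarrow> i \<in> {..<N}" using monoms_out[OF eM] by auto
    moreover have "e \<in> - hit S"
    proof
      assume "e \<in> hit S"
      then have "inc u e \<in> hit S" by (auto simp: hit_def)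
      then show False using e by simp
    qed
    ultimately show ?thesis by (auto simp: basis_def)
  qed
  show "?v \<in> K {..<N} k (n - deg u)"
    unfolding K_def by (rule rdiv_supported[OF w']) (use key in blast)
  have "?v \<in> supported {e. deg u \<le> n}"
    by (rule rdiv_supported[OF w']) (use key in blast)
  then show "deg u \<le> n" if "?v \<noteq> 0"
    using that by (cases "deg u \<le> n") (simp_all add: supported_empty)
  show "?v \<in> supported (- hit S)"
    by (rule rdiv_supported[OF w']) (use key in blast)
  show "m u = 0" if "m \<in> esupp ?v" "odd (deg u)" for m
    using that by (auto simp: esupp_def rdiv_def split: if_splits)
qed

text \<open>Cohomology of the quotient by \<open>u\<close>: an even \<open>u\<close> acts injectively, while for an odd \<open>u\<close> the
  ideal it generates is itself a shifted copy of the quotient, whence the induction on \<open>k\<close> below.\<close>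
lemma qexact_insert:
  assumes S: "S \<subseteq> Us" and u: "u \<in> Us" "u \<notin> S"
    and main: "qexact S k n"
    and prev: "\<And>p. n + 1 = p + deg u \<Longrightarrow> 1 \<le> k \<Longrightarrow> K {..<N} (k - 1) p \<noteq> {0} \<Longrightarrow>
      1 \<le> p \<and> qexact (if even (deg u) then S else insert u S) (k - 1) p"
  shows "qexact (insert u S) k n"
  unfolding qexact_def
proof (intro ballI impI)
  fix a assume a: "a \<in> K {..<N} k n" "D a \<in> supported (hit (insert u S))"
  let ?T = "if even (deg u) then S else insert u S"
  have T: "?T \<subseteq> Us" using S u by auto
  have UsN: "Us \<subseteq> {..<N}" by (rule Us_sub)
  have up: "f \<in> supported (hit S) \<Longrightarrow> f \<in> supported (hit (insert u S))" for f
    using supported_mono[of "hit S" "hit (insert u S)"] by (auto simp: hit_def)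
  show "\<exists>c\<in>K {..<N} (Suc k) (n - 1). a - D c \<in> supported (hit (insert u S))"
  proof (cases "D a \<in> supported (hit S)")
    case True
    then show ?thesis using main a(1) up unfolding qexact_def by blast
  next
    \<comment> \<open>Here \<open>D a\<close> is congruent to \<open>v u\<close> modulo
      \<open>S\<close> with \<open>v\<close> nonzero. Once \<open>v\<close> is matched by some
      \<open>D b\<close>, the element \<open>a - b u\<close> is a cocycle modulo \<open>S\<close>
      and agrees with \<open>a\<close> modulo \<open>u\<close>.\<close>
    case False
    then have k: "1 \<le> k" using D_K_0[of a "{..<N}" n] a(1) by (cases k) auto
    have Da: "D a \<in> K {..<N} (k - 1) (Suc n)" using D_K[OF a(1) UsN] .
    obtain v where v: "v \<in> K {..<N} (k - 1) (Suc n - deg u)" "v \<noteq> 0 \<Longrightarrow> deg u \<le> Suc n"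
      "v \<in> supported (- hit S)" "D a = proj (hit S) (D a) + amul deg v (gen u)"
      "\<And>m. m \<in> esupp v \<Longrightarrow> odd (deg u) \<Longrightarrow> m u = 0"
      using quotient_split[OF Da a(2) u(1)] by metis
    let ?p = "Suc n - deg u"
    let ?x = "proj (hit S) (D a)"
    have xA: "?x \<in> \<A>" and xS: "?x \<in> supported (hit S)"
      using supported_proj[OF K_A[OF Da], of "hit S"] by (simp_all flip: supported_Int)
    have v0: "v \<noteq> 0"
    proof
      assume "v = 0"
      then have "D a = ?x" using v(4) by simp
      then show False using False xS by simp
    qed
    have p: "n + 1 = ?p + deg u" using v(2)[OF v0] by simp
    have "K {..<N} (k - 1) ?p \<noteq> {0}" using v(1) v0 by blast
    then have pr: "1 \<le> ?p" "qexact ?T (k - 1) ?p" using prev[OF p k] by auto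
    \<comment> \<open>Applying \<open>D\<close> again puts \<open>(D v) u\<close> into the ideal of
      \<open>S\<close>. An even \<open>u\<close> can be cancelled there; an odd one only up to terms
      containing \<open>u\<close>, which \<open>?T\<close> permits.\<close>
    have "0 = D (D a)" using D_D[OF K_A[OF a(1)]] by simp
    also have "\<dots> = D ?x + D (amul deg v (gen u))"
      using D_add[OF xA K_A[OF amul_gen_U_K[OF v(1) u(1) UsN]]] v(4) by simp
    also have "D (amul deg v (gen u)) = amul deg (D v) (gen u)" by (rule Leibniz_U[OF v(1) u(1)])
    finally have "D ?x + amul deg (D v) (gen u) = 0" by (rule sym)
    then have "amul deg (D v) (gen u) = 0 - D ?x" by (simp only: add_eq_0_iff diff_0)
    also have "\<dots> \<in> supported (hit S)"
      using D_hit[OF xA xS S] by (intro supported_diff) auto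
    finally have Dvu: "amul deg (D v) (gen u) \<in> supported (hit S)" .
    have DvK: "D v \<in> K {..<N} (k - 1 - 1) (Suc ?p)" using D_K[OF v(1) UsN] .
    have "D v \<in> supported (hit ?T)"
    proof -
      have "e \<in> hit ?T" if e: "e \<in> esupp (D v)" for e
      proof (cases "odd (deg u) \<and> e u \<noteq> 0")
        case True
        then show ?thesis by (auto simp: hit_def)
      next
        case False
        then have "inc u e \<in> esupp (amul deg (D v) (gen u))"
          by (intro esupp_amul_gen_inc[OF K_finite[OF DvK] e]) auto
        then have "inc u e \<in> hit S" using Dvu by (auto simp: supported_def)
        then have "e \<in> hit S" using u(2) by (auto simp: hit_def split: if_splits)
        then show ?thesis by (auto simp: hit_def)
      qed
      then show ?thesis using K_finite[OF DvK] by (auto simp: supported_def)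
    qed
    then obtain b where b: "b \<in> K {..<N} k (?p - 1)" "v - D b \<in> supported (hit ?T)"
      using pr(2) v(1) k unfolding qexact_def by auto
    have "?p - 1 + deg u = n" using pr(1) p by simp
    then have bu: "amul deg b (gen u) \<in> K {..<N} k n" using amul_gen_U_K[OF b(1) u(1) UsN] by simp
    let ?a = "a - amul deg b (gen u)"
    have DbK: "D b \<in> K {..<N} (k - 1) (Suc (?p - 1))" using D_K[OF b(1) UsN] .
    have "D ?a = D a - amul deg (D b) (gen u)"
      using D_diff[OF K_A[OF a(1)] K_A[OF bu]] Leibniz_U[OF b(1) u(1)] by simp
    also have "\<dots> = ?x + amul deg (v - D b) (gen u)"
      using v(4) amul_gen_diff[OF K_finite[OF v(1)] K_finite[OF DbK], of deg u]
      by (metis add_diff_eq)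
    \<comment> \<open>For odd \<open>u\<close>, the terms of \<open>v - D b\<close> that contain
      \<open>u\<close> are killed by the multiplication with \<open>u\<close>.\<close>
    also have "\<dots> \<in> supported (hit S)"
    proof (rule supported_add[OF xS])
      show "amul deg (v - D b) (gen u) \<in> supported (hit S)"
      proof (rule amul_gen_supported[OF b(2)])
        fix m assume "m \<in> hit ?T" "odd (deg u) \<Longrightarrow> m u = 0"
        then have "m \<in> hit S" by (auto simp: hit_def split: if_splits)
        then show "inc u m \<in> hit S" by (auto simp: hit_def)
      qed
    qed
    finally obtain c where c: "c \<in> K {..<N} (Suc k) (n - 1)" "?a - D c \<in> supported (hit S)"
      using main K_diff[OF a(1) bu] unfolding qexact_def by blast
    have "amul deg b (gen u) \<in> supported (hit (insert u S))"
      by (rule amul_gen_supported[of b UNIV]) (use K_finite[OF b(1)] in \<open>auto simp: hit_def supported_def\<close>)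
    then have "(?a - D c) + amul deg b (gen u) \<in> supported (hit (insert u S))"
      using up[OF c(2)] by (rule supported_add[rotated])
    moreover have "(?a - D c) + amul deg b (gen u) = a - D c" by simp
    ultimately show ?thesis using c(1) by auto
  qed
qed

section \<open>Dividing out the even generators of U\<close>

lemma K_trivial: "n < 2 * k \<Longrightarrow> K G k n = {0}"
proof -
  assume "n < 2 * k"
  then have "f = 0" if "f \<in> K G k n" for f
    using K_nonzero[OF that] by linarith
  then show ?thesis using K_0 by blast
qed

text \<open>Each even generator costs one unit of V-length, as \<open>qexact_insert\<close> draws on
  \<open>S\<close> both at \<open>k'\<close> and at \<open>k' - 1\<close>. Since
  \<open>k' \<ge> 2\<close>, a nonzero piece of length \<open>k' - 1\<close> has positive
  degree.\<close>

lemma qexact_even: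
  assumes "\<And>k' n. k \<le> k' \<Longrightarrow> qexact {} k' n" "1 \<le> k"
    and "finite S" "S \<subseteq> Us" "\<And>u. u \<in> S \<Longrightarrow> even (deg u)" "k + card S \<le> k'"
  shows "qexact S k' n"
  using assms(3-6)
proof (induction S arbitrary: k' n rule: finite_induct)
  case empty
  then show ?case using assms(1) by simp
next
  case (insert u S k' n)
  show ?case
  proof (rule qexact_insert)
    show "qexact S k' n" using insert by simp
    fix p assume p: "K {..<N} (k' - 1) p \<noteq> {0}"
    have "2 * (k' - 1) \<le> p" using p K_trivial by (meson not_le)
    moreover have "2 \<le> k'" using insert assms(2) by simp
    ultimately have "1 \<le> p" by linarith
    moreover have "qexact S (k' - 1) p" using insert by simp
    ultimately show "1 \<le> p \<and> qexact (if even (deg u) then S else insert u S) (k' - 1) p"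
      using insert.prems by simp
  qed (use insert in auto)
qed

section \<open>The product of all odd generators\<close>

definition top_mono :: mono where
  "top_mono = (\<lambda>i. if i < N \<and> odd (deg i) then 1 else 0)"

lemma top_Mon: "top_mono \<in> Mon"
  by (auto simp: top_mono_def monoms_def)

text \<open>As \<open>V\<close> is odd, a term outside the ideal would contain odd generators only,
  each at most once, and so would divide \<open>top_mono\<close>; but \<open>D\<close> raises the
  degree.\<close>

lemma D_top:
  assumes "\<And>v. v \<in> Vs \<Longrightarrow> odd (deg v)"
  shows "D (mon top_mono) \<in> supported (hit {u \<in> Us. even (deg u)})"
proof (rule D_supported)
  show "mon top_mono \<in> supported {top_mono}" by simp
  show "{top_mono} \<subseteq> Mon" using top_Mon by simp
  fix m e assume "m \<in> {top_mono}" and de: "dstep m e"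
  then have de: "dstep top_mono e" by simp
  note pr = dstep_props[OF de top_Mon]
  show "e \<in> hit {u \<in> Us. even (deg u)}"
  proof (rule ccontr)
    assume "\<not> ?thesis"
    then have ev: "e u = 0" if "u \<in> Us" "even (deg u)" for u using that by (auto simp: hit_def)
    have "e i * deg i \<le> top_mono i * deg i" if "i < N" for i
    proof (cases "odd (deg i)")
      case True
      then have "e i \<le> 1" using pr(1) by (simp add: monoms_def)
      then show ?thesis using True that by (simp add: top_mono_def)
    next
      case False
      then have "i \<in> Us" using assms that Us_Vs by auto
      then show ?thesis using ev False by simp
    qed
    then have "dg e \<le> dg top_mono" unfolding mdeg_def by (intro sum_mono) auto
    then show False using pr(3) by simp
  qed
qed

lemma vlen_top:
  assumes "\<And>v. v \<in> Vs \<Longrightarrow> odd (deg v)"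
  shows "vlen top_mono = card Vs"
proof -
  have "vlen top_mono = (\<Sum>i\<in>Vs. 1)"
    unfolding vlen_def top_mono_def by (rule sum.cong) (use assms Vs_lt in auto)
  then show ?thesis by simp
qed

lemma vlen_le_card:
  assumes "\<And>v. v \<in> Vs \<Longrightarrow> odd (deg v)" "e \<in> Mon"
  shows "vlen e \<le> card Vs"
proof -
  have "vlen e \<le> (\<Sum>i\<in>Vs. 1)"
    unfolding vlen_def by (rule sum_mono) (use assms in \<open>auto simp: monoms_def\<close>)
  then show ?thesis by simp
qed

text \<open>By rigidity, exactness at \<open>k\<close> carries over to V-length
  \<open>card Vs\<close> modulo the even generators. There \<open>mon top_mono\<close> is a cocycle.
  No monomial has V-length \<open>card Vs + 1\<close>, so \<open>top_mono\<close> would have to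
  contain an even generator.\<close>

lemma not_exact_on:
  assumes odd: "\<And>v. v \<in> Vs \<Longrightarrow> odd (deg v)"
    and k: "1 \<le> k" "k + card {u \<in> Us. even (deg u)} \<le> card Vs"
  shows "\<not> exact_on {..<N} k"
proof
  assume ex: "exact_on {..<N} k"
  let ?X = "{u \<in> Us. even (deg u)}" and ?n = "dg top_mono"
  have q: "qexact ?X (card Vs) ?n"
  proof (rule qexact_even[of k])
    fix k' n assume "k \<le> k'"
    then show "qexact {} k' n" using exact_on_ge[OF ex k(1) odd] by (intro exact_on_qexact)
  qed (use k finite_Us in auto)
  have "mon top_mono \<in> K {..<N} (card Vs) ?n"
    unfolding K_def using top_Mon vlen_top[OF odd] monoms_out[OF top_Mon] by (simp add: basis_def)
  then obtain c where c: "c \<in> K {..<N} (Suc (card Vs)) (?n - 1)" "mon top_mono - D c \<in> supported (hit ?X)"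
    using q D_top[OF odd] unfolding qexact_def by blast
  have "basis {..<N} (Suc (card Vs)) (?n - 1) = {}"
    using vlen_le_card[OF odd] unfolding basis_def by fastforce
  then have "c = 0" using c(1) by (simp add: K_def supported_empty)
  then have "top_mono \<in> hit ?X" using c(2) by simp
  then show False by (auto simp: hit_def top_mono_def)
qed

text \<open>For an odd \<open>u\<close>, \<open>qexact_insert\<close> refers back to
  \<open>insert u S\<close> itself at length \<open>k - 1\<close> and degree
  \<open>n + 1 - deg u \<ge> n - \<mu>\<close>. Hence the inner induction on \<open>k\<close> and
  the loss of at most \<open>\<mu>\<close> in degree per unit of length.\<close>

lemma qexact_odd:
  assumes base: "\<And>k n. C < n \<Longrightarrow> qexact {} k n"
    and "finite S" "S \<subseteq> Us" "\<And>u. u \<in> S \<Longrightarrow> odd (deg u) \<and> deg u \<le> \<mu> + 1" "C + k * \<mu> < n"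
  shows "qexact S k n"
  using assms(2-5)
proof (induction S arbitrary: k n rule: finite_induct)
  case empty
  then show ?case using base by simp
next
  case (insert u S k n)
  show ?case using insert.prems(3)
  proof (induction k arbitrary: n)
    case 0
    show ?case
      by (rule qexact_insert) (use insert 0 in auto)
  next
    case (Suc k n)
    show ?case
    proof (rule qexact_insert)
      show "qexact S (Suc k) n" using insert Suc.prems by simp
      fix p assume p: "n + 1 = p + deg u"
      have "deg u \<le> \<mu> + 1" "odd (deg u)" using insert.prems by auto
      then have "C + k * \<mu> < p" using p Suc.prems by simp
      then show "1 \<le> p \<and> qexact (if even (deg u) then S else insert u S) (Suc k - 1) p"
        using Suc.IH \<open>odd (deg u)\<close> by simp
    qed (use insert in auto)
  qed
qed

text \<open>If \<open>z\<close> were an even generator of \<open>V\<close>, the powers of \<open>z\<close> would be cocycles modulo the odd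
  generators of degree below \<open>deg z\<close>, and not boundaries for lack of a factor in \<open>U\<close>.\<close>
lemma odd_Vs:
  assumes base: "\<And>k n. C < n \<Longrightarrow> qexact {} k n" and z: "z \<in> Vs"
  shows "odd (deg z)"
proof
  assume ev: "even (deg z)"
  \<comment> \<open>With this choice \<open>?S\<close> collects the odd generators of
    \<open>U\<close> of degree below \<open>deg z\<close>. The exponent \<open>?k = C + 1\<close>
    makes the degree \<open>?k (\<mu> + 2)\<close> of the power of \<open>z\<close> exceed
    \<open>C + ?k \<mu>\<close>.\<close>
  define \<mu> where "\<mu> = deg z - 2"
  let ?S = "{u \<in> Us. odd (deg u) \<and> deg u \<le> \<mu> + 1}"
  let ?k = "Suc C"
  define m :: mono where "m = (\<lambda>j. if j = z then ?k else 0)"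
  have zN: "z < N" "z \<notin> Us" using z by (auto simp: Vs_def)
  have z2: "2 \<le> deg z" using deg_ge2 zN by simp
  have mM: "m \<in> Mon" using zN ev by (auto simp: m_def monoms_def)
  have "dg m = (\<Sum>i<N. if i = z then ?k * deg z else 0)"
    unfolding mdeg_def by (rule sum.cong) (auto simp: m_def)
  then have dgm: "dg m = ?k * deg z" using zN by simp
  have "vlen m = (\<Sum>i\<in>Vs. if i = z then ?k else 0)"
    unfolding vlen_def by (rule sum.cong) (auto simp: m_def)
  then have vm: "vlen m = ?k" using z finite_Vs by simp
  have mK: "mon m \<in> K {..<N} ?k (dg m)"
    unfolding K_def using mM vm zN by (simp add: basis_def m_def)
  have "deg z = \<mu> + 2" using z2 by (simp add: \<mu>_def)
  then have "C + ?k * \<mu> < dg m" unfolding dgm by (simp add: algebra_simps)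
  then have q: "qexact ?S ?k (dg m)"
    by (intro qexact_odd[OF base, where \<mu> = \<mu>]) (use finite_Us in auto)
  have Dm: "D (mon m) \<in> supported (hit ?S)"
  proof (rule D_supported[of _ "{m}"])
    fix m' e assume "m' \<in> {m}" "dstep m' e"
    then have "dstep m e" by simp
    then obtain i b where i: "i \<in> Vs" "m i > 0" "b \<in> dimages i" "e = (\<lambda>j. dec i m j + b j)"
      unfolding dstep_def by blast
    have "i = z" using i(2) by (simp add: m_def split: if_splits)
    then have b: "b \<in> Mon" "\<And>j. b j \<noteq> 0 \<Longrightarrow> j \<in> Us" "dg b = deg z + 1" "2 \<le> mlen N b"
      using i(3) by (auto simp: dimages_def)
    \<comment> \<open>The degree \<open>deg z + 1\<close> of \<open>b\<close> is odd, so some odd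
      generator \<open>j\<close> occurs in it. By minimality another factor, of degree at least 2,
      remains, whence \<open>deg j \<le> deg z - 1\<close>.\<close>
    have "\<exists>j<N. odd (b j * deg j)"
    proof (rule ccontr)
      assume "\<not> ?thesis"
      then have "even (dg b)" unfolding mdeg_def by (intro dvd_sum) auto
      then show False using b(3) ev by simp
    qed
    then obtain j where j: "j < N" "odd (b j * deg j)" by blast
    then have j': "b j \<noteq> 0" "odd (deg j)" by (auto elim: oddE)
    have "dg b = dg (dec j b) + deg j" by (rule dg_dec) (use j j' in auto)
    moreover have "2 \<le> dg (dec j b)"
    proof -
      have id: "inc j (dec j b) = b" using j' by (intro inc_dec) simp
      have "mlen N b = mlen N (dec j b) + 1"
        using mlen_inc[OF j(1), of "dec j b"] unfolding id .
      then show ?thesis using b(4) dg_ge_mlen[of "dec j b"] by linarith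
    qed
    ultimately have "deg j \<le> \<mu> + 1" using b(3) \<open>deg z = \<mu> + 2\<close> by linarith
    then have "j \<in> ?S" using b(2) j' by simp
    moreover have "e j \<noteq> 0" unfolding i(4) using j' by simp
    ultimately show "e \<in> hit ?S" unfolding hit_def by blast
  qed (use mM in auto)
  obtain c where c: "c \<in> K {..<N} (Suc ?k) (dg m - 1)" "mon m - D c \<in> supported (hit ?S)"
    using q mK Dm unfolding qexact_def by blast
  \<comment> \<open>Both \<open>D c\<close> and \<open>mon m - D c\<close> lie in the ideal
    generated by \<open>U\<close>, whereas a pure power of \<open>z\<close> does not.\<close>
  have "D c \<in> supported (hit Us)"
    using c(1) unfolding K_def
  proof (rule D_supported[OF _ basis_Mon])
    fix m' e assume "m' \<in> basis {..<N} (Suc ?k) (dg m - 1)" "dstep m' e"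
    then have "\<exists>u\<in>Us. e u > 0" using dstep_props(6)[of m' e] by (auto simp: basis_def)
    then show "e \<in> hit Us" by (auto simp: hit_def)
  qed
  moreover have "mon m - D c \<in> supported (hit Us)"
    using c(2) supported_mono[of "hit ?S" "hit Us"] by (auto simp: hit_def)
  ultimately have "(mon m - D c) + D c \<in> supported (hit Us)" by (rule supported_add[rotated])
  then have "m \<in> hit Us" by simp
  then show False using zN by (auto simp: hit_def m_def split: if_splits)
qed

section \<open>Bigraded dimensions\<close>

abbreviation KF :: "nat \<Rightarrow> nat \<Rightarrow> elem set" where "KF \<equiv> K {..<N}"
abbreviation BF :: "nat \<Rightarrow> nat \<Rightarrow> mono set" where "BF \<equiv> basis {..<N}"

lemma mem_BF: "e \<in> BF k n \<longleftrightarrow> e \<in> Mon \<and> vlen e = k \<and> dg e = n"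
  unfolding basis_def using monoms_out by auto

definition cocyc :: "nat \<Rightarrow> nat \<Rightarrow> elem set" where
  "cocyc k n = {a \<in> KF k n. D a = 0}"

definition cobd :: "nat \<Rightarrow> nat \<Rightarrow> elem set" where
  "cobd k n = (if n = 0 then {0} else D ` KF (Suc k) (n - 1))"

text \<open>The dimension of the cohomology in V-length \<open>k\<close> and degree
  \<open>n\<close>; by \<open>cobd_le_cocyc\<close> the subtraction is never truncated.\<close>

definition bidim :: "nat \<Rightarrow> nat \<Rightarrow> nat" where
  "bidim k n = Q.dim (cocyc k n) - Q.dim (cobd k n)"

lemma cobd_cocyc: "cobd k n \<subseteq> cocyc k n"
proof
  fix x assume x: "x \<in> cobd k n"
  show "x \<in> cocyc k n"
  proof (cases n)
    case 0
    then show ?thesis using x by (simp add: cobd_def cocyc_def)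
  next
    case (Suc m)
    then obtain b where b: "b \<in> KF (Suc k) m" "x = D b" using x by (auto simp: cobd_def)
    then show ?thesis
      using D_K_Suc[OF b(1) Us_sub] D_D[OF K_A[OF b(1)]] Suc by (simp add: cocyc_def)
  qed
qed

lemma cocyc_KF: "cocyc k n \<subseteq> KF k n"
  by (auto simp: cocyc_def)

lemma KF_span: "KF k n \<subseteq> Q.span (mon ` BF k n)"
  unfolding K_def by (rule supported_span[OF finite_basis])

lemma dim_KF: "Q.dim (KF k n) = card (BF k n)"
  unfolding K_def by (rule dim_supported[OF finite_basis])

lemma D_add_KF: "x \<in> KF k n \<Longrightarrow> y \<in> KF k n \<Longrightarrow> D (x + y) = D x + D y"
  and D_scale_KF: "x \<in> KF k n \<Longrightarrow> D (qscale c x) = qscale c (D x)"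
  using D_add D_scale K_A by blast+

lemma subspace_D_image:
  assumes "Q.subspace V" "V \<subseteq> \<A>"
  shows "Q.subspace (D ` V)"
proof (rule Q.subspaceI)
  show "0 \<in> D ` V" using Q.subspace_0[OF assms(1)] by (intro image_eqI[of _ _ 0]) auto
next
  fix x y assume "x \<in> D ` V" "y \<in> D ` V"
  then obtain a b where ab: "a \<in> V" "b \<in> V" "x = D a" "y = D b" by auto
  then have "x + y = D (a + b)" using D_add[OF subsetD[OF assms(2) ab(1)] subsetD[OF assms(2) ab(2)]] by simp
  then show "x + y \<in> D ` V" using Q.subspace_add[OF assms(1) ab(1,2)] by (rule image_eqI)
next
  fix c x assume "x \<in> D ` V"
  then obtain a where a: "a \<in> V" "x = D a" by auto
  then have "qscale c x = D (qscale c a)" using D_scale[OF subsetD[OF assms(2) a(1)], of c] by simp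
  then show "qscale c x \<in> D ` V" using Q.subspace_scale[OF assms(1) a(1)] by (rule image_eqI)
qed

lemma cobd_subspace: "Q.subspace (cobd k n)"
  unfolding cobd_def
proof (cases "n = 0")
  case False
  have "Q.subspace (D ` KF (Suc k) (n - 1))"
    by (rule subspace_D_image[OF K_subspace]) (rule subsetI, erule K_A)
  then show "Q.subspace (if n = 0 then {0} else D ` KF (Suc k) (n - 1))" using False by simp
qed (simp add: Q.subspace_single_0)

lemma cobd_le_cocyc: "Q.dim (cobd k n) \<le> Q.dim (cocyc k n)"
  by (rule Q.dim_mono_finite[of _ _ "mon ` BF k n"])
    (use cobd_cocyc cocyc_KF KF_span finite_basis Q.span_base in blast)+

lemma bidim_eq_0: "bidim k n = 0 \<longleftrightarrow> cocyc k n = cobd k n"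
proof
  assume "bidim k n = 0"
  then have "Q.dim (cocyc k n) \<le> Q.dim (cobd k n)" by (simp add: bidim_def)
  then have "cobd k n = cocyc k n"
    by (intro Q.span_eq_if_dim_le[of _ _ "mon ` BF k n"] cobd_subspace cobd_cocyc)
      (use cocyc_KF KF_span finite_basis in blast)+
  then show "cocyc k n = cobd k n" by simp
qed (simp add: bidim_def)

lemma rank_nullity_D: "card (BF (Suc k) n) = Q.dim (cocyc (Suc k) n) + Q.dim (cobd k (Suc n))"
proof -
  have "Q.dim (KF (Suc k) n) = Q.dim {x \<in> KF (Suc k) n. D x = 0} + Q.dim (D ` KF (Suc k) n)"
    by (rule Q.rank_nullity_on[OF K_subspace KF_span])
      (simp_all add: finite_basis D_add_KF D_scale_KF)
  then show ?thesis by (simp add: dim_KF cocyc_def cobd_def)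
qed

lemma dim_cocyc_0: "Q.dim (cocyc 0 n) = card (BF 0 n)"
proof -
  have "cocyc 0 n = KF 0 n" using D_K_0 by (auto simp: cocyc_def)
  then show ?thesis by (simp add: dim_KF)
qed

lemma bidim_trivial: "n < 2 * k \<Longrightarrow> bidim k n = 0"
proof -
  assume "n < 2 * k"
  then have "cocyc k n \<subseteq> {0}" using K_trivial cocyc_KF by metis
  moreover have "0 \<in> cobd k n" using cobd_subspace by (rule Q.subspace_0)
  ultimately show "bidim k n = 0" unfolding bidim_eq_0 using cobd_cocyc[of k n] by auto
qed

lemma cobd_0: "Q.dim (cobd k 0) = 0"
proof -
  have "Q.dim {0} \<le> card ({} :: elem set)" by (rule Q.dim_le_card) auto
  then show ?thesis by (simp add: cobd_def)
qed

text \<open>\<open>D\<close> lowers the V-length by exactly one, hence commutes with the projections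
  up to a shift. This splits the cohomology by V-length.\<close>

lemma proj_D:
  assumes "b \<in> \<A>"
  shows "proj {e. vlen e = k} (D b) = D (proj {e. vlen e = Suc k} b)"
proof -
  let ?S = "{e. vlen e = Suc k}" and ?R = "{e. vlen e = k}"
  have s: "proj ?S b \<in> supported (Mon \<inter> ?S)" "proj (- ?S) b \<in> supported (Mon \<inter> - ?S)"
    using assms by (auto intro: supported_proj)
  have A: "proj ?S b \<in> \<A>" "proj (- ?S) b \<in> \<A>"
    using s supported_mono[of "Mon \<inter> ?S" Mon] supported_mono[of "Mon \<inter> - ?S" Mon] by auto
  have 1: "D (proj ?S b) \<in> supported ?R"
    by (rule D_supported[OF s(1)]) (auto dest: dstep_props)
  have 2: "D (proj (- ?S) b) \<in> supported (- ?R)"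
    by (rule D_supported[OF s(2)]) (auto dest: dstep_props)
  have "D b = D (proj ?S b + proj (- ?S) b)" using proj_split[of b ?S] by simp
  also have "\<dots> = D (proj ?S b) + D (proj (- ?S) b)" by (rule D_add[OF A])
  finally have "proj ?R (D b) = proj ?R (D (proj ?S b)) + proj ?R (D (proj (- ?S) b))"
    by (simp add: proj_add)
  then show ?thesis using proj_id[OF 1] proj_eq_0[OF 2, of ?R] by simp
qed

section \<open>Comparison with the cohomology of a whole degree\<close>

lemma KF_Int: "KF k n = supported {e \<in> Mon. dg e = n} \<inter> supported {e. vlen e = k}"
proof -
  have "BF k n = {e \<in> Mon. dg e = n} \<inter> {e. vlen e = k}" using mem_BF by blast
  then show ?thesis unfolding supported_Int K_def by simp
qed

lemma finite_degree: "finite {e \<in> Mon. dg e = n}" and vlen_le_dg: "vlen e \<le> dg e"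
proof -
  show le: "vlen e \<le> dg e" for e using dg_ge_mlen[of e] vlen_le_mlen[of e] by linarith
  have "{e \<in> Mon. dg e = n} \<subseteq> (\<Union>k\<le>n. BF k n)" using le by (auto simp: mem_BF)
  then show "finite {e \<in> Mon. dg e = n}" by (rule finite_subset) (simp add: finite_basis)
qed

lemma proj_KF: "f \<in> supported {e \<in> Mon. dg e = n} \<Longrightarrow> proj {e. vlen e = k} f \<in> KF k n"
  unfolding KF_Int supported_Int by (rule supported_proj)

text \<open>Cocycles and coboundaries are both stable under projection to a V-length, so
  \<open>dim_graded\<close> applies to each. V-length never exceeds degree, hence the range of
  \<open>k\<close>.\<close>

lemma Hdim_eq: "Hdim N deg D n = (\<Sum>k\<le>n. bidim k n)"
proof -
  let ?S = "{e \<in> Mon. dg e = n}"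
  have SA: "supported ?S \<subseteq> \<A>" by (rule supported_mono) auto
  have KFS: "KF k n \<subseteq> supported ?S" for k by (auto simp: KF_Int)
  have Z: "cocycles N deg D n = {f \<in> supported ?S. D f = 0}"
    by (simp add: cocycles_def homog_iff)
  have "Q.dim (cocycles N deg D n) = (\<Sum>k\<le>n. Q.dim (cocycles N deg D n \<inter> supported {e. vlen e = k}))"
  proof (rule dim_graded[OF finite_degree])
    show "Q.subspace (cocycles N deg D n)"
      unfolding Z by (rule Q.subspaceI)
        (use SA in \<open>auto simp: supported_add supported_qscale D_add D_scale subset_iff\<close>)
    show "proj {e. vlen e = k} f \<in> cocycles N deg D n" if f: "f \<in> cocycles N deg D n" for f k
    proof -
      have "f \<in> supported ?S" "D f = 0" using f by (auto simp: Z)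
      moreover have "D (proj {e. vlen e = k} f) = 0"
      proof (cases k)
        case 0
        then show ?thesis using D_K_0[OF proj_KF] \<open>f \<in> supported ?S\<close> by blast
      next
        case (Suc j)
        have "f \<in> \<A>" using SA \<open>f \<in> supported ?S\<close> by blast
        then show ?thesis using proj_D[of f j] Suc \<open>D f = 0\<close> by simp
      qed
      ultimately show ?thesis using subsetD[OF KFS proj_KF] by (auto simp: Z)
    qed
  qed (use vlen_le_dg in \<open>auto simp: Z\<close>)
  also have "\<dots> = (\<Sum>k\<le>n. Q.dim (cocyc k n))"
    by (rule sum.cong[OF refl], rule arg_cong[of _ _ Q.dim]) (auto simp: Z cocyc_def KF_Int)
  finally have 1: "Q.dim (cocycles N deg D n) = (\<Sum>k\<le>n. Q.dim (cocyc k n))" .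
  have 2: "Q.dim (coboundaries N deg D n) = (\<Sum>k\<le>n. Q.dim (cobd k n))"
  proof (cases n)
    case 0
    then show ?thesis using cobd_0 by (simp add: coboundaries_def cobd_def)
  next
    case (Suc m)
    let ?T = "{e \<in> Mon. dg e = m}"
    have TA: "supported ?T \<subseteq> \<A>" by (rule supported_mono) auto
    have "{f. homog N deg m f} = supported ?T" by (auto simp: homog_iff)
    then have B: "coboundaries N deg D n = D ` supported ?T"
      by (simp add: coboundaries_def Suc)
    have "Q.dim (coboundaries N deg D n) = (\<Sum>k\<le>n. Q.dim (coboundaries N deg D n \<inter> supported {e. vlen e = k}))"
    proof (rule dim_graded[OF finite_degree])
      show "Q.subspace (coboundaries N deg D n)"
        unfolding B by (rule subspace_D_image[OF subspace_supported TA])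
      show "coboundaries N deg D n \<subseteq> supported ?S"
        unfolding B
      proof (rule image_subsetI)
        fix b assume "b \<in> supported ?T"
        then show "D b \<in> supported ?S"
          by (rule D_supported) (auto dest: dstep_props simp: Suc)
      qed
      show "proj {e. vlen e = k} f \<in> coboundaries N deg D n" if f: "f \<in> coboundaries N deg D n" for f k
      proof -
        obtain b where b: "b \<in> supported ?T" "f = D b" using f by (auto simp: B)
        have "proj {e. vlen e = k} f = D (proj {e. vlen e = Suc k} b)"
          using proj_D b TA by blast
        moreover have "proj {e. vlen e = Suc k} b \<in> supported ?T"
          using proj_KF[OF b(1)] by (auto simp: KF_Int)
        ultimately show ?thesis by (auto simp: B)
      qed
    qed (use vlen_le_dg in auto)
    also have "\<dots> = (\<Sum>k\<le>n. Q.dim (cobd k n))"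
    proof (rule sum.cong[OF refl], rule arg_cong[of _ _ Q.dim], intro set_eqI iffI)
      fix k x assume x: "x \<in> coboundaries N deg D n \<inter> supported {e. vlen e = k}"
      then obtain b where b: "b \<in> supported ?T" "x = D b" by (auto simp: B)
      have "x = proj {e. vlen e = k} x" using x proj_id by auto
      also have "\<dots> = D (proj {e. vlen e = Suc k} b)" using proj_D b TA by blast
      finally show "x \<in> cobd k n" using proj_KF[OF b(1)] by (auto simp: cobd_def Suc)
    next
      fix k x assume x: "x \<in> cobd k n"
      then have "x \<in> KF k n" using cobd_cocyc cocyc_KF by blast
      moreover have "x \<in> D ` supported ?T" using x by (auto simp: cobd_def Suc KF_Int)
      ultimately show "x \<in> coboundaries N deg D n \<inter> supported {e. vlen e = k}"
        by (auto simp: B KF_Int)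
    qed
    finally show ?thesis .
  qed
  show ?thesis
    unfolding Hdim_def qdim_eq 1 2 bidim_def by (rule sum_subtractf_nat[symmetric]) (rule cobd_le_cocyc)
qed

section \<open>Exactness and lower bounds in terms of \<open>bidim\<close>\<close>

lemma bidim_qexact: "bidim k n = 0 \<Longrightarrow> 0 < n \<Longrightarrow> qexact {} k n"
proof -
  assume "bidim k n = 0" "0 < n"
  then have "cocyc k n = D ` KF (Suc k) (n - 1)" unfolding bidim_eq_0 by (simp add: cobd_def)
  then show ?thesis unfolding qexact_def hit_empty supported_empty cocyc_def by force
qed

lemma not_exact_on_bidim: "\<not> exact_on {..<N} k \<Longrightarrow> 1 \<le> k \<Longrightarrow> \<exists>n. 1 \<le> bidim k n"
proof -
  assume "\<not> exact_on {..<N} k" and k: "1 \<le> k"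
  then obtain n a where a: "a \<in> KF k n" "D a = 0" "\<And>b. b \<in> KF (Suc k) (n - 1) \<Longrightarrow> D b \<noteq> a"
    unfolding exact_on_def by blast
  have "n \<noteq> 0"
  proof
    assume "n = 0"
    then have "a = 0" using a(1) K_trivial[of n k] k by auto
    then show False using a(3)[of 0] by simp
  qed
  then have "a \<notin> cobd k n" using a(3) by (auto simp: cobd_def)
  then have "cocyc k n \<noteq> cobd k n" using a(1,2) by (auto simp: cocyc_def)
  then show ?thesis using bidim_eq_0[of k n] by (intro exI[of _ n]) simp
qed

text \<open>In V-length 0 everything is a cocycle, and by minimality all terms of boundaries have
  length at least 2; this gives the first bound. For the second, the quadratic part of a boundary is
  a combination of those of \<open>D (gen v)\<close> with \<open>deg v + 1 = n\<close>: a monomial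
  with a further factor besides \<open>v\<close> has a differential of length at least 3.\<close>

lemma bidim_0_ge:
  "card {e \<in> BF 0 n. mlen N e \<le> 1} \<le> bidim 0 n"
  "card {e \<in> BF 0 n. mlen N e \<le> 2} \<le> bidim 0 n + card {v \<in> Vs. deg v + 1 = n}"
proof -
  have split: "card (BF 0 n) = card {e \<in> BF 0 n. mlen N e \<le> l} + card {e \<in> BF 0 n. l < mlen N e}" for l
    by (subst card_Un_disjoint[symmetric]) (auto simp: finite_basis intro: arg_cong[of _ _ card])
  have sup: "{e \<in> BF 0 n. l < mlen N e} \<subseteq> BF 0 n" for l by auto
  have fin: "finite {e \<in> BF 0 n. l < mlen N e}" for l using finite_basis by simp
  have cob: "x \<in> supported {e \<in> BF 0 n. 1 < mlen N e}" if xc: "x \<in> cobd 0 n" for x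
  proof (cases "n = 0")
    case True
    then show ?thesis using xc by (simp add: cobd_def)
  next
    case False
    then obtain b where b: "b \<in> KF (Suc 0) (n - 1)" "x = D b" using xc by (auto simp: cobd_def)
    show ?thesis
      using b(1) unfolding b(2) K_def
    proof (rule D_supported[OF _ basis_Mon])
      fix m e assume "m \<in> BF (Suc 0) (n - 1)" "dstep m e"
      then show "e \<in> {e \<in> BF 0 n. 1 < mlen N e}"
        using dstep_props(1-4)[of m e] False by (simp add: mem_BF)
    qed
  qed
  have "Q.dim (cobd 0 n) \<le> card {e \<in> BF 0 n. 1 < mlen N e}"
    unfolding dim_supported[OF fin, symmetric]
    by (rule Q.dim_mono_finite[OF _ supported_span[OF fin]])
      (use cob Q.span_base fin in auto)
  then show "card {e \<in> BF 0 n. mlen N e \<le> 1} \<le> bidim 0 n"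
    unfolding bidim_def dim_cocyc_0 split[of 1] by simp
  let ?M = "{e. mlen N e \<le> 2}" and ?V = "{v \<in> Vs. deg v + 1 = n}"
  have fV: "finite ?V" using finite_Vs by simp
  have cobS: "cobd 0 n \<subseteq> Q.span (mon ` BF 0 n)"
    using cobd_cocyc cocyc_KF KF_span by blast
  \<comment> \<open>Rank-nullity for truncation at length 2: the kernel lies in the span of the
    longer monomials, the image in the span of at most \<open>card ?V\<close> vectors.\<close>
  have rn: "Q.dim (cobd 0 n) = Q.dim {x \<in> cobd 0 n. proj ?M x = 0} + Q.dim (proj ?M ` cobd 0 n)"
    by (rule Q.rank_nullity_on[OF cobd_subspace cobS]) (simp_all add: finite_basis proj_add proj_qscale)
  have ker: "Q.dim {x \<in> cobd 0 n. proj ?M x = 0} \<le> card {e \<in> BF 0 n. 2 < mlen N e}"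
    unfolding dim_supported[OF fin, symmetric]
  proof (rule Q.dim_mono_finite[OF _ supported_span[OF fin]])
    show "{x \<in> cobd 0 n. proj ?M x = 0} \<subseteq> Q.span (supported {e \<in> BF 0 n. 2 < mlen N e})"
    proof
      fix x assume "x \<in> {x \<in> cobd 0 n. proj ?M x = 0}"
      then have x: "x \<in> cobd 0 n" "proj ?M x = 0" by simp_all
      have x1: "x \<in> KF 0 n" by (rule subsetD[OF cocyc_KF subsetD[OF cobd_cocyc x(1)]])
      have "x = proj ?M x + proj (- ?M) x" by (rule proj_split)
      also have "\<dots> = proj (- ?M) x" by (simp only: x(2) add_0_left)
      also have "\<dots> \<in> supported (BF 0 n \<inter> - ?M)" using x1 unfolding K_def by (rule supported_proj)
      also have "BF 0 n \<inter> - ?M = {e \<in> BF 0 n. 2 < mlen N e}" by auto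
      finally show "x \<in> Q.span (supported {e \<in> BF 0 n. 2 < mlen N e})" by (rule Q.span_base)
    qed
  qed (use fin in simp)
  have "Q.dim (proj ?M ` cobd 0 n) \<le> card ((\<lambda>v. proj ?M (D (gen v))) ` ?V)"
  proof (rule Q.dim_le_card)
    show "proj ?M ` cobd 0 n \<subseteq> Q.span ((\<lambda>v. proj ?M (D (gen v))) ` ?V)"
    proof (rule image_subsetI)
      fix x assume x: "x \<in> cobd 0 n"
      show "proj ?M x \<in> Q.span ((\<lambda>v. proj ?M (D (gen v))) ` ?V)"
      proof (cases "n = 0")
        case True
        then have "proj ?M x = 0" using x by (simp add: cobd_def proj_def fun_eq_iff)
        then show ?thesis by (simp add: Q.span_zero)
      next
        case False
        then obtain b where b: "b \<in> KF (Suc 0) (n - 1)" "x = D b" using x by (auto simp: cobd_def)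
        have monD: "proj ?M (D (mon m)) \<in> Q.span ((\<lambda>v. proj ?M (D (gen v))) ` ?V)"
          if m: "m \<in> BF (Suc 0) (n - 1)" for m
        proof -
          have m': "m \<in> Mon" "vlen m = 1" "dg m = n - 1" using m by (auto simp: mem_BF)
          obtain v where v: "v \<in> Vs" "m v > 0"
          proof -
            have "\<exists>v\<in>Vs. m v \<noteq> 0"
            proof (rule ccontr)
              assume "\<not> ?thesis"
              then have "vlen m = 0" unfolding vlen_def by simp
              then show False using m' by simp
            qed
            then show ?thesis using that by auto
          qed
          have vN: "v < N" using v Vs_lt by simp
          have id: "inc v (dec v m) = m" using v(2) by (rule inc_dec)
          have l: "mlen N m = mlen N (dec v m) + 1" using mlen_inc[OF vN, of "dec v m"] unfolding id .
          show ?thesis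
          proof (cases "dec v m = 0")
            case True
            have "m = inc v (dec v m)" using id by (rule sym)
            also have "\<dots> = inc v 0" by (simp only: True)
            also have "\<dots> = unit_mono v" by (auto simp: unit_mono_def)
            finally have "m = unit_mono v" .
            then have gm: "mon m = gen v" by (simp add: gen_eq_mon)
            have "dg m = deg v" unfolding \<open>m = unit_mono v\<close> by (rule mdeg_unit[OF vN])
            then have "v \<in> ?V" using v(1) m' False by simp
            then show ?thesis unfolding gm by (intro Q.span_base) blast
          next
            case dec: False
            then have "mlen N (dec v m) \<noteq> 0" using mlen_eq_0[OF dec_monoms[OF m'(1)]] by blast
            then have m2: "2 \<le> mlen N m" using l by simp
            have "D (mon m) \<in> supported (- ?M)"
            proof (rule D_supported[of _ "{m}"])
              fix m'' e assume "m'' \<in> {m}" "dstep m'' e"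
              then obtain i c where i: "i \<in> Vs" "m i > 0" "c \<in> dimages i" "e = (\<lambda>j. dec i m j + c j)"
                unfolding dstep_def by blast
              have id: "inc i (dec i m) = m" using i(2) by (rule inc_dec)
              have "mlen N m = mlen N (dec i m) + 1"
                using mlen_inc[OF Vs_lt[OF i(1)], of "dec i m"] unfolding id .
              moreover have "2 \<le> mlen N c" using i(3) by (simp add: dimages_def)
              moreover have "mlen N e = mlen N (dec i m) + mlen N c" unfolding i(4) by (rule mlen_add)
              ultimately have "2 < mlen N e" using m2 by linarith
              then show "e \<in> - ?M" by simp
            qed (use m' in auto)
            then have "proj ?M (D (mon m)) = 0" by (rule proj_eq_0) simp
            then show ?thesis by (simp only: Q.span_zero)
          qed
        qed
        have bs: "esupp b \<subseteq> BF (Suc 0) (n - 1)" "finite (esupp b)" using b(1) by (auto simp: K_def supported_def)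
        have pD: "proj ?M (D (\<Sum>m\<in>I. qscale (b m) (mon m))) \<in> Q.span ((\<lambda>v. proj ?M (D (gen v))) ` ?V)"
          if "finite I" "I \<subseteq> BF (Suc 0) (n - 1)" for I
          using that
        proof (induction I rule: finite_induct)
          case empty
          show ?case by (simp only: sum.empty D_0 proj_0 Q.span_zero)
        next
          case (insert m I)
          have mM: "m \<in> Mon" "I \<subseteq> Mon" using insert.prems by (auto simp: mem_BF)
          then have mA: "mon m \<in> \<A>" "qscale (b m) (mon m) \<in> \<A>"
            by (simp_all add: supported_qscale)
          have IA: "(\<Sum>m\<in>I. qscale (b m) (mon m)) \<in> \<A>"
            using mM(2) by (intro supported_sum supported_qscale) auto
          have eq: "proj ?M (D (\<Sum>m\<in>insert m I. qscale (b m) (mon m))) =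
              qscale (b m) (proj ?M (D (mon m))) + proj ?M (D (\<Sum>m\<in>I. qscale (b m) (mon m)))"
            using insert.hyps D_add[OF mA(2) IA] D_scale[OF mA(1)] by (simp add: proj_add proj_qscale)
          show ?case
            unfolding eq using insert.prems by (intro Q.span_add Q.span_scale monD insert.IH) auto
        qed
        have "x = D (\<Sum>m\<in>esupp b. qscale (b m) (mon m))"
          unfolding b(2) by (rule arg_cong[OF expand_mon[OF bs(2) subset_refl]])
        then show ?thesis using pD[OF bs(2,1)] by simp
      qed
    qed
  qed (use fV in simp)
  also have "card ((\<lambda>v. proj ?M (D (gen v))) ` ?V) \<le> card ?V" using fV by (rule card_image_le)
  finally have "Q.dim (cobd 0 n) \<le> card {e \<in> BF 0 n. 2 < mlen N e} + card ?V"
    using rn ker by linarith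
  then show "card {e \<in> BF 0 n. mlen N e \<le> 2} \<le> bidim 0 n + card ?V"
    unfolding bidim_def dim_cocyc_0 split[of 2] by simp
qed

end

section \<open>Euler characteristic\<close>

unbundle fps_syntax

text \<open>The derivative does not vanish at 1, so the root is simple.\<close>

lemma order_one_minus_monom:
  assumes "0 < m"
  shows "1 - monom (1::rat) m \<noteq> 0" "order 1 (1 - monom (1::rat) m) = 1"
proof -
  let ?p = "1 - monom (1::rat) m"
  have d: "pderiv ?p = - monom (of_nat m) (m - 1)"
    by (simp add: pderiv_diff pderiv_monom)
  have nz: "poly (pderiv ?p) 1 \<noteq> 0" unfolding d using assms by (simp add: poly_monom)
  then have p0: "pderiv ?p \<noteq> 0" by auto
  then have pn: "?p \<noteq> 0" by auto
  have pz: "poly ?p 1 = 0" by (simp add: poly_monom)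
  show "?p \<noteq> 0" by (rule pn)
  have "order 1 ?p = Suc (order 1 (pderiv ?p))" using pn pz by (rule order_pderiv)
  then show "order 1 ?p = 1" using order_0I[OF nz] by simp
qed

lemma order_one_plus_monom: "order 1 (1 + monom (1::rat) m) = 0"
  by (rule order_0I) (simp add: poly_monom)

context two_stage_sullivan
begin

text \<open>The weight of a single generator. \<open>D\<close> raises the degree and lowers the
  V-length by one, so it preserves their sum, and each weight carries a finite complex with an Euler
  characteristic.\<close>

definition wt :: "nat \<Rightarrow> nat" where
  "wt i = deg i + (if i \<in> Vs then 1 else 0)"

definition weight :: "mono \<Rightarrow> nat" where
  "weight e = dg e + vlen e"

definition below :: "nat \<Rightarrow> nat \<Rightarrow> mono set" where
  "below j w = {e \<in> monoms j deg. weight e = w}"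

text \<open>Restricting to the first \<open>j\<close> generators opens the product formula to
  induction.\<close>

definition euler :: "nat \<Rightarrow> rat fps" where
  "euler j = Abs_fps (\<lambda>w. \<Sum>e\<in>below j w. (-1) ^ vlen e)"

lemma monoms_le: "j \<le> N \<Longrightarrow> monoms j deg \<subseteq> Mon"
  by (auto simp: monoms_def)

lemma finite_below: "j \<le> N \<Longrightarrow> finite (below j w)"
proof (rule finite_subset)
  assume "j \<le> N"
  then show "below j w \<subseteq> (\<Union>n\<le>w. {e \<in> Mon. dg e = n})"
    using subsetD[OF monoms_le] by (auto simp: below_def weight_def)
qed (simp add: finite_degree)

lemma weight_inc: "i < N \<Longrightarrow> weight (inc i m) = weight m + wt i"
  unfolding weight_def wt_def vlen_inc by (simp add: mdeg_inc del: fun_upd_apply)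

text \<open>A monomial containing the last generator is that generator times a cofactor, which is
  free of it in the odd case but may contain it again in the even case.\<close>

lemma below_Suc:
  assumes "j < N"
  shows "below (Suc j) w = below j w \<union>
    (if wt j \<le> w then inc j ` below (if odd (deg j) then j else Suc j) (w - wt j) else {})"
    (is "_ = _ \<union> ?R")
proof (intro set_eqI iffI)
  fix e assume e: "e \<in> below (Suc j) w"
  show "e \<in> below j w \<union> ?R"
  proof (cases "e j = 0")
    case True
    then have "e \<in> monoms j deg"
      using e by (auto simp: below_def monoms_def) (metis le_neq_implies_less Suc_leI)
    then show ?thesis using e by (simp add: below_def)
  next
    case False
    have id: "inc j (dec j e) = e" using False by (intro inc_dec) simp
    have w: "w = weight (dec j e) + wt j"
      using weight_inc[OF assms, of "dec j e"] e unfolding id by (simp add: below_def)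
    have e1: "e i \<le> 1" if "odd (deg i)" for i using e that by (simp add: below_def monoms_def)
    have e0: "e i = 0" if "Suc j \<le> i" for i using e that by (simp add: below_def monoms_def)
    have "dec j e \<in> monoms (if odd (deg j) then j else Suc j) deg"
      unfolding monoms_def mem_Collect_eq
    proof (intro conjI allI impI)
      fix i assume i: "(if odd (deg j) then j else Suc j) \<le> i"
      show "dec j e i = 0"
      proof (cases "i = j")
        case True
        then have "odd (deg j)" using i by (auto split: if_splits)
        then show ?thesis using e1[of j] True by simp
      next
        case False
        then show ?thesis using e0[of i] i by (auto split: if_splits)
      qed
    next
      fix i assume "odd (deg i)"
      then show "dec j e i \<le> 1" using e1[of i] by (cases "i = j") auto
    qed
    then have "dec j e \<in> below (if odd (deg j) then j else Suc j) (w - wt j)"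
      using w by (simp add: below_def)
    then have "e \<in> inc j ` below (if odd (deg j) then j else Suc j) (w - wt j)"
      by (rule rev_image_eqI) (rule id[symmetric])
    then show ?thesis using w by simp
  qed
next
  fix e assume "e \<in> below j w \<union> ?R"
  then consider "e \<in> below j w" | m where "wt j \<le> w" "e = inc j m"
    "m \<in> below (if odd (deg j) then j else Suc j) (w - wt j)"
    by (auto split: if_splits)
  then show "e \<in> below (Suc j) w"
  proof cases
    case 1
    then show ?thesis by (simp add: below_def monoms_def)
  next
    case 2
    have m: "m \<in> monoms (if odd (deg j) then j else Suc j) deg" "weight m = w - wt j"
      using 2(3) by (auto simp: below_def)
    have "weight e = w" unfolding 2(2) weight_inc[OF assms] using m(2) 2(1) by simp
    moreover have "e \<in> monoms (Suc j) deg"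
      unfolding monoms_def mem_Collect_eq
    proof (intro conjI allI impI)
      fix i assume "Suc j \<le> i"
      then show "e i = 0" using m(1) unfolding 2(2) by (auto simp: monoms_def split: if_splits)
    next
      fix i assume i: "odd (deg i)"
      show "e i \<le> 1"
      proof (cases "i = j")
        case True
        then have "m j = 0" using m(1) i by (simp add: monoms_def)
        then show ?thesis unfolding 2(2) using True by simp
      next
        case False
        then show ?thesis unfolding 2(2) using m(1) i by (simp add: monoms_def)
      qed
    qed
    ultimately show ?thesis by (simp add: below_def)
  qed
qed

text \<open>For even \<open>deg j\<close> this is an implicit equation for
  \<open>euler (Suc j)\<close>, which encodes a geometric series.\<close>

lemma euler_Suc:
  assumes "j < N"
  shows "euler (Suc j) = euler j + (if j \<in> Vs then - 1 else 1) * fps_X ^ wt j *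
    euler (if odd (deg j) then j else Suc j)"
proof (rule fps_ext)
  fix w
  let ?p = "if odd (deg j) then j else Suc j" and ?s = "if j \<in> Vs then - 1 else 1 :: rat"
  have j: "j \<le> N" "?p \<le> N" using assms by auto
  let ?R = "if wt j \<le> w then inc j ` below ?p (w - wt j) else {}"
  have "below j w \<inter> ?R = {}"
    by (auto simp: below_def monoms_def)
  moreover have "finite ?R" using finite_below[OF j(2)] by simp
  ultimately have "euler (Suc j) $ w = euler j $ w + (\<Sum>e\<in>?R. (-1) ^ vlen e)"
    unfolding euler_def fps_nth_Abs_fps below_Suc[OF assms]
    by (intro sum.union_disjoint finite_below[OF j(1)])
  also have "(\<Sum>e\<in>?R. (-1) ^ vlen e) = ?s * (if w < wt j then 0 else euler ?p $ (w - wt j))"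
  proof (cases "wt j \<le> w")
    case True
    have "(\<Sum>e\<in>inc j ` below ?p (w - wt j). (-1) ^ vlen e) =
        (\<Sum>m\<in>below ?p (w - wt j). (-1) ^ vlen (inc j m) :: rat)"
      by (subst sum.reindex) (auto intro!: inj_onI simp: inc_inj simp del: fun_upd_apply)
    also have "\<dots> = ?s * euler ?p $ (w - wt j)"
      unfolding vlen_inc euler_def fps_nth_Abs_fps sum_distrib_left
      by (rule sum.cong) auto
    finally show ?thesis using True by simp
  qed simp
  finally show "euler (Suc j) $ w = (euler j + (if j \<in> Vs then - 1 else 1) * fps_X ^ wt j * euler ?p) $ w"
    by (simp add: fps_X_power_mult_nth mult.assoc split: if_splits)
qed

lemma euler_0: "euler 0 = 1"
proof (rule fps_ext)
  fix w
  have "below 0 w = (if w = 0 then {0} else {})"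
  proof (intro set_eqI)
    fix e
    have "e \<in> monoms 0 deg \<longleftrightarrow> e = 0" by (auto simp: monoms_def fun_eq_iff)
    moreover have "weight 0 = 0" by (simp only: weight_def dg_0 vlen_0)
    ultimately show "e \<in> below 0 w \<longleftrightarrow> e \<in> (if w = 0 then {0} else {})"
      unfolding below_def by auto
  qed
  then show "euler 0 $ w = 1 $ w" by (simp add: euler_def)
qed

text \<open>With \<open>q\<close> the variable and \<open>w = wt j\<close>, an even generator
  contributes \<open>1 - q^w\<close> to \<open>A\<close>, a generator of \<open>V\<close>
  contributes \<open>1 - q^w\<close> to \<open>B\<close>, and an odd generator of \<open>U\<close>
  contributes \<open>1 + q^w\<close> to \<open>B\<close>, which does not vanish at 1. Keeping
  \<open>A\<close> on the left avoids dividing power series.\<close>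

lemma euler_product:
  assumes odd: "\<And>v. v \<in> Vs \<Longrightarrow> odd (deg v)" and "j \<le> N"
  shows "\<exists>A B. euler j * fps_of_poly A = fps_of_poly B \<and> A \<noteq> 0 \<and> B \<noteq> 0 \<and>
    order 1 A = card {i \<in> {..<j}. even (deg i)} \<and> order 1 B = card ({..<j} \<inter> Vs)"
  using assms(2)
proof (induction j)
  case 0
  show ?case by (rule exI[of _ 1], rule exI[of _ 1]) (simp add: euler_0)
next
  case (Suc j)
  then obtain A B where AB: "euler j * fps_of_poly A = fps_of_poly B" "A \<noteq> 0" "B \<noteq> 0"
    "order 1 A = card {i \<in> {..<j}. even (deg i)}" "order 1 B = card ({..<j} \<inter> Vs)"
    by auto
  have jN: "j < N" using Suc by simp
  have w0: "0 < wt j" using deg_ge2[OF jN] by (simp add: wt_def)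
  have X: "fps_X ^ wt j = fps_of_poly (monom (1::rat) (wt j))"
    by (simp add: fps_of_poly_monom')
  let ?m = "1 - monom (1::rat) (wt j)" and ?q = "1 + monom (1::rat) (wt j)"
  have om: "order 1 ?m = 1" "order 1 ?q = 0"
    by (rule order_one_minus_monom(2)[OF w0], rule order_one_plus_monom)
  have m0: "?m \<noteq> 0" by (rule order_one_minus_monom(1)[OF w0])
  have "poly ?q 1 \<noteq> 0" by (simp add: poly_monom)
  then have q0: "?q \<noteq> 0" by (metis poly_0)
  let ?E = "\<lambda>j. {i \<in> {..<j}. even (deg i)}" and ?V = "\<lambda>j. {..<j} \<inter> Vs"
  have E: "?E (Suc j) = (if even (deg j) then insert j (?E j) else ?E j)"
    "?V (Suc j) = (if j \<in> Vs then insert j (?V j) else ?V j)"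
    by (auto simp: less_Suc_eq)
  have "card (insert j (?E j)) = card (?E j) + 1" "card (insert j (?V j)) = card (?V j) + 1"
    by (subst card_insert_disjoint; simp)+
  then have cE: "card (?E (Suc j)) = card (?E j) + (if even (deg j) then 1 else 0)"
    and cV: "card (?V (Suc j)) = card (?V j) + (if j \<in> Vs then 1 else 0)"
    unfolding E by (simp_all split: if_splits)
  have nz: "A * ?m \<noteq> 0" "B * ?m \<noteq> 0" "B * ?q \<noteq> 0" using AB(2,3) m0 q0 by simp_all
  note ord = nz[THEN order_mult, of 1]
  consider (even) "even (deg j)" "j \<notin> Vs" | (oddV) "odd (deg j)" "j \<in> Vs" | (oddU) "odd (deg j)" "j \<notin> Vs"
    using odd by blast
  then show ?case
  proof cases
    case even
    have eq: "euler (Suc j) = euler j + fps_X ^ wt j * euler (Suc j)"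
      using euler_Suc[OF jN] even by (simp only: if_False if_True mult_1 simp_thms)
    have "euler (Suc j) * fps_of_poly ?m = euler (Suc j) - fps_X ^ wt j * euler (Suc j)"
      unfolding X by (simp add: fps_of_poly_diff algebra_simps)
    also have "\<dots> = euler j" using eq by (simp only: diff_eq_eq)
    finally have em: "euler (Suc j) * fps_of_poly ?m = euler j" .
    have "euler (Suc j) * fps_of_poly (A * ?m) = euler (Suc j) * fps_of_poly ?m * fps_of_poly A"
      unfolding fps_of_poly_mult by (simp only: ac_simps)
    also have "\<dots> = fps_of_poly B" unfolding em by (rule AB(1))
    finally have "euler (Suc j) * fps_of_poly (A * ?m) = fps_of_poly B" .
    moreover have "order 1 (A * ?m) = card (?E (Suc j))" "order 1 B = card (?V (Suc j))"
      unfolding ord cE cV om AB(4,5) using even by simp_all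
    ultimately show ?thesis using nz(1) AB(3) by blast
  next
    case oddV
    have "euler (Suc j) = euler j - fps_X ^ wt j * euler j"
      using euler_Suc[OF jN] oddV by simp
    then have "euler (Suc j) = euler j * fps_of_poly ?m"
      unfolding X by (simp add: fps_of_poly_diff algebra_simps)
    then have "euler (Suc j) * fps_of_poly A = fps_of_poly (B * ?m)"
      unfolding fps_of_poly_mult AB(1)[symmetric] by (simp add: algebra_simps)
    moreover have "order 1 A = card (?E (Suc j))" "order 1 (B * ?m) = card (?V (Suc j))"
      unfolding ord cE cV om AB(4,5) using oddV by simp_all
    ultimately show ?thesis using nz(2) AB(2) by blast
  next
    case oddU
    have "euler (Suc j) = euler j + fps_X ^ wt j * euler j"
      using euler_Suc[OF jN] oddU by simp
    then have "euler (Suc j) = euler j * fps_of_poly ?q"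
      unfolding X by (simp add: fps_of_poly_add algebra_simps)
    then have "euler (Suc j) * fps_of_poly A = fps_of_poly (B * ?q)"
      unfolding fps_of_poly_mult AB(1)[symmetric] by (simp add: algebra_simps)
    moreover have "order 1 A = card (?E (Suc j))" "order 1 (B * ?q) = card (?V (Suc j))"
      unfolding ord cE cV om AB(4,5) using oddU by simp_all
    ultimately show ?thesis using nz(3) AB(2) by blast
  qed
qed

lemma euler_N_nth: "euler N $ w = (\<Sum>k\<le>w. (-1) ^ k * of_nat (card (BF k (w - k))))"
proof -
  have "euler N $ w = (\<Sum>e\<in>below N w. (-1) ^ vlen e)" by (simp add: euler_def)
  also have "\<dots> = (\<Sum>k\<le>w. \<Sum>e\<in>{e \<in> below N w. vlen e = k}. (-1) ^ vlen e)"
    by (rule sum.group[symmetric]) (auto simp: finite_below, auto simp: below_def weight_def)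
  also have "\<dots> = (\<Sum>k\<le>w. (-1) ^ k * of_nat (card (BF k (w - k))))"
  proof (rule sum.cong[OF refl])
    fix k assume "k \<in> {..w}"
    then have eq: "{e \<in> below N w. vlen e = k} = BF k (w - k)"
      by (auto simp: below_def weight_def mem_BF)
    have "(\<Sum>e\<in>{e \<in> below N w. vlen e = k}. (-1) ^ vlen e) = (\<Sum>e\<in>{e \<in> below N w. vlen e = k}. (-1) ^ k :: rat)"
      by (rule sum.cong) auto
    then show "(\<Sum>e\<in>{e \<in> below N w. vlen e = k}. (-1) ^ vlen e) = (-1) ^ k * (of_nat (card (BF k (w - k))) :: rat)"
      unfolding eq by simp
  qed
  finally show ?thesis .
qed

text \<open>Rank-nullity replaces dimensions of chains by those of cohomology. The boundary terms
  telescope, and the last one, in degree 0, vanishes.\<close>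

lemma euler_N_bidim: "euler N $ w = (\<Sum>k\<le>w. (-1) ^ k * of_nat (bidim k (w - k)))"
proof -
  define z where "z k = (of_nat (Q.dim (cocyc k (w - k))) :: rat)" for k
  define b where "b k = (of_nat (Q.dim (cobd k (w - k))) :: rat)" for k
  define c where "c k = (of_nat (card (BF k (w - k))) :: rat)" for k
  have c0: "c 0 = z 0" by (simp add: c_def z_def dim_cocyc_0)
  have cS: "c (Suc k) = z (Suc k) + b k" if "k < w" for k
  proof -
    have "Suc (w - Suc k) = w - k" using that by simp
    then show ?thesis using rank_nullity_D[of k "w - Suc k"] by (simp add: c_def z_def b_def)
  qed
  have hk: "of_nat (bidim k (w - k)) = z k - b k" for k
    unfolding bidim_def z_def b_def using cobd_le_cocyc by (simp add: of_nat_diff)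
  have "(\<Sum>k\<le>j. (-1) ^ k * c k) = (\<Sum>k\<le>j. (-1) ^ k * (z k - b k)) + (-1) ^ j * b j" if "j \<le> w" for j
    using that
  proof (induction j)
    case 0
    then show ?case by (simp add: c0)
  next
    case (Suc j)
    then show ?case using cS[of j] by (simp add: algebra_simps)
  qed
  moreover have "b w = 0" by (simp add: b_def cobd_0)
  ultimately show ?thesis unfolding euler_N_nth hk c_def[symmetric] by simp
qed

end

section \<open>The dimension estimate\<close>

lemma unit_mono_eq_iff: "unit_mono i = unit_mono j \<longleftrightarrow> i = j"
  by (metis unit_mono_simps zero_neq_one)

context two_stage_sullivan
begin

section \<open>Monomials of length at most 2 in U\<close>

lemma card_le_sum_degrees:
  assumes "finite S" "S \<subseteq> {e \<in> Mon. vlen e = 0 \<and> mlen N e \<le> l}" "\<And>e. e \<in> S \<Longrightarrow> dg e \<le> L"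
  shows "card S \<le> (\<Sum>n\<le>L. card {e \<in> BF 0 n. mlen N e \<le> l})"
proof -
  have "S = (\<Union>n\<le>L. {e \<in> S. dg e = n})" using assms(3) by auto
  then have "card S \<le> (\<Sum>n\<le>L. card {e \<in> S. dg e = n})"
    using card_UN_le[of "{..L}" "\<lambda>n. {e \<in> S. dg e = n}"] by simp
  also have "\<dots> \<le> (\<Sum>n\<le>L. card {e \<in> BF 0 n. mlen N e \<le> l})"
  proof (intro sum_mono card_mono)
    fix n
    show "{e \<in> S. dg e = n} \<subseteq> {e \<in> BF 0 n. mlen N e \<le> l}" using assms(2) by (auto simp: mem_BF)
  qed (simp add: finite_basis)
  finally show ?thesis .
qed

definition linear_monos :: "mono set" where
  "linear_monos = insert 0 (unit_mono ` Us)"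

lemma zero_Mon: "0 \<in> Mon"
  by (simp add: monoms_def)

lemma linear_monos:
  "finite linear_monos" "linear_monos \<subseteq> {e \<in> Mon. vlen e = 0 \<and> mlen N e \<le> 1}"
  "card linear_monos = 1 + card Us"
proof -
  show "finite linear_monos" by (simp add: linear_monos_def finite_Us)
  have u: "unit_mono u \<in> Mon \<and> vlen (unit_mono u) = 0 \<and> mlen N (unit_mono u) = 1" if "u \<in> Us" for u
    using that Us_lt[OF that] Us_Vs(1) by (auto simp: unit_Mon vlen_unit mlen_unit)
  show "linear_monos \<subseteq> {e \<in> Mon. vlen e = 0 \<and> mlen N e \<le> 1}"
  proof
    fix e assume "e \<in> linear_monos"
    then consider "e = 0" | u where "u \<in> Us" "e = unit_mono u" by (auto simp: linear_monos_def)
    then show "e \<in> {e \<in> Mon. vlen e = 0 \<and> mlen N e \<le> 1}"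
    proof cases
      case 1
      have "(0::mono) \<in> {e \<in> Mon. vlen e = 0 \<and> mlen N e \<le> 1}"
        unfolding mem_Collect_eq mlen_0 vlen_0 by (intro conjI zero_Mon) simp_all
      then show ?thesis unfolding 1 .
    next
      case 2
      then show ?thesis using u[of u] by simp
    qed
  qed
  have "0 \<notin> unit_mono ` Us"
  proof
    assume "0 \<in> unit_mono ` Us"
    then obtain u where "0 = unit_mono u" by blast
    then have "(0::mono) u = unit_mono u u" by (rule fun_cong)
    then show False by simp
  qed
  moreover have "card (unit_mono ` Us) = card Us"
    by (rule card_image) (simp add: inj_on_def unit_mono_eq_iff)
  ultimately show "card linear_monos = 1 + card Us"
    unfolding linear_monos_def using finite_Us by simp
qed

text \<open>Of the quadratic monomials in the even generators only \<open>2 |X| - 1\<close> are needed.\<close>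
lemma quadratic_monos:
  assumes "x0 \<in> Us" "even (deg x0)"
  obtains S where "finite S" "S \<subseteq> {e \<in> Mon. vlen e = 0 \<and> mlen N e \<le> 2}"
    "card S + 1 = 1 + card Us + 2 * card {u \<in> Us. even (deg u)}"
proof
  let ?X = "{u \<in> Us. even (deg u)}"
  define p :: "nat \<Rightarrow> nat \<Rightarrow> mono" where "p x y = (\<lambda>i. unit_mono x i + unit_mono y i)" for x y
  \<comment> \<open>\<open>P\<close> holds the products of \<open>x0\<close> with every even
    generator, \<open>x0\<close> included, and \<open>R\<close> the squares of the others:
    \<open>2 * card ?X - 1\<close> monomials in all.\<close>
  define P where "P = p x0 ` ?X"
  define R where "R = (\<lambda>x. p x x) ` (?X - {x0})"
  have fX: "finite ?X" using finite_Us by simp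
  have pp: "p x y \<in> Mon \<and> vlen (p x y) = 0 \<and> mlen N (p x y) = 2" if "x \<in> ?X" "y \<in> ?X" for x y
  proof -
    have xy: "x < N" "y < N" "x \<notin> Vs" "y \<notin> Vs" using that Us_lt Us_Vs(1) by auto
    have "p x y \<in> Mon"
      unfolding p_def by (rule add_Mon) (use xy that unit_Mon in \<open>auto simp: unit_mono_def\<close>)
    then show ?thesis using xy by (simp add: p_def vlen_add mlen_add vlen_unit mlen_unit)
  qed
  have PR: "P \<union> R \<subseteq> {e \<in> Mon. vlen e = 0 \<and> mlen N e = 2}"
    unfolding P_def R_def using pp assms by auto
  let ?S = "linear_monos \<union> (P \<union> R)"
  have fin: "finite P" "finite R" using fX by (simp_all add: P_def R_def)
  show "finite ?S" using fin linear_monos(1) by simp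
  show "?S \<subseteq> {e \<in> Mon. vlen e = 0 \<and> mlen N e \<le> 2}"
    using PR linear_monos(2) by fastforce
  have "card P = card ?X"
    unfolding P_def
  proof (rule card_image, rule inj_onI)
    fix x y assume "p x0 x = p x0 y"
    then have "unit_mono x = unit_mono y" by (simp add: p_def fun_eq_iff)
    then show "x = y" by (simp add: unit_mono_eq_iff)
  qed
  moreover have "card R = card (?X - {x0})"
    unfolding R_def
  proof (rule card_image, rule inj_onI)
    fix x y assume eq: "p x x = p y y"
    have "unit_mono x = unit_mono y"
    proof
      fix i
      show "unit_mono x i = unit_mono y i" using fun_cong[OF eq, of i] unfolding p_def by linarith
    qed
    then show "x = y" by (simp add: unit_mono_eq_iff)
  qed
  moreover have "card (?X - {x0}) + 1 = card ?X"
    using assms fX by (metis (no_types, lifting) Suc_eq_plus1 card_Suc_Diff1 mem_Collect_eq)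
  moreover have "P \<inter> R = {}"
  proof (rule ccontr)
    assume "P \<inter> R \<noteq> {}"
    then obtain x y where xy: "y \<noteq> x0" "p x0 x = p y y" by (auto simp: P_def R_def)
    then have "p x0 x x0 = p y y x0" by simp
    then show False using xy(1) by (simp add: p_def)
  qed
  moreover have "linear_monos \<inter> (P \<union> R) = {}"
    using PR linear_monos(2) by fastforce
  ultimately show "card ?S + 1 = 1 + card Us + 2 * card ?X"
    using linear_monos(1,3) fin by (simp add: card_Un_disjoint)
qed

theorem dimension_bound:
  assumes "elliptic N deg D"
  shows "N \<le> total_Hdim N deg D"
proof -
  have fin: "finite {n. Hdim N deg D n \<noteq> 0}" using assms by (simp add: elliptic_def)
  then obtain C where C: "\<And>n. Hdim N deg D n \<noteq> 0 \<Longrightarrow> n \<le> C"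
    using finite_nat_set_iff_bounded_le[of "{n. Hdim N deg D n \<noteq> 0}"] by blast
  have hC: "bidim k n = 0" if "C < n" for k n
  proof (cases "k \<le> n")
    case True
    have "Hdim N deg D n = 0" using C[of n] that by (cases "Hdim N deg D n = 0") auto
    then have "\<forall>k\<in>{..n}. bidim k n = 0" unfolding Hdim_eq by (subst (asm) sum_eq_0_iff) auto
    then show ?thesis using True by simp
  next
    case False
    then show ?thesis by (intro bidim_trivial) simp
  qed
  \<comment> \<open>A nonzero class of V-length \<open>k\<close> has degree at least
    \<open>2 * k\<close>, so the bound on degrees also bounds the length.\<close>
  have hk: "bidim k n = 0" if "C < k" for k n
    using hC[of n k] bidim_trivial[of n k] that by (cases "C < n") auto
  have hk': "k \<le> C" if "0 < bidim k n" for k n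
    using hk[of k n] that by (cases "C < k") auto
  have odd: "odd (deg v)" if "v \<in> Vs" for v
    by (rule odd_Vs[OF _ that, of C]) (use bidim_qexact hC in auto)
  define H where "H k = (\<Sum>n\<le>C. bidim k n)" for k
  have total: "total_Hdim N deg D = (\<Sum>k\<le>C. H k)"
  proof -
    have "total_Hdim N deg D = (\<Sum>n\<le>C. Hdim N deg D n)"
      unfolding total_Hdim_def by (rule sum.mono_neutral_left) (use C in auto)
    also have "\<dots> = (\<Sum>n\<le>C. \<Sum>k\<le>C. bidim k n)"
    proof (rule sum.cong[OF refl])
      fix n assume "n \<in> {..C}"
      then show "Hdim N deg D n = (\<Sum>k\<le>C. bidim k n)"
        unfolding Hdim_eq by (intro sum.mono_neutral_left) (auto simp: bidim_trivial)
    qed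
    also have "\<dots> = (\<Sum>k\<le>C. H k)" unfolding H_def by (rule sum.swap)
    finally show ?thesis .
  qed
  let ?X = "{u \<in> Us. even (deg u)}"
  have fX: "finite ?X" using finite_Us by simp
  have XUs: "card ?X \<le> card Us" by (rule card_mono) (auto simp: finite_Us)
  have NUV: "N = card Us + card Vs"
    using card_Un_disjoint[OF finite_Us finite_Vs Us_Vs(1)] Us_Vs(2) by simp
  have X_eq: "{i \<in> {..<N}. even (deg i)} = ?X" using odd Us_Vs Us_lt by auto
  have V_eq: "{..<N} \<inter> Vs = Vs" using Us_Vs by auto
  have H0: "card S \<le> H 0" if S: "finite S" "S \<subseteq> {e \<in> Mon. vlen e = 0 \<and> mlen N e \<le> 1}" for S
  proof -
    \<comment> \<open>The bound is enlarged to cover the degrees of all monomials in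
      \<open>S\<close>; the added degrees contribute nothing to \<open>H 0\<close>.\<close>
    let ?L = "C + (\<Sum>e\<in>S. dg e)"
    have "dg e \<le> ?L" if "e \<in> S" for e using member_le_sum[of e S dg] that S(1) by simp
    then have "card S \<le> (\<Sum>n\<le>?L. card {e \<in> BF 0 n. mlen N e \<le> 1})"
      using S by (intro card_le_sum_degrees) auto
    also have "\<dots> \<le> (\<Sum>n\<le>?L. bidim 0 n)" by (intro sum_mono bidim_0_ge(1))
    also have "\<dots> = H 0"
      unfolding H_def by (rule sum.mono_neutral_right) (auto simp: hC not_le)
    finally show ?thesis .
  qed
  have H0': "card S \<le> H 0 + card Vs" if S: "finite S" "S \<subseteq> {e \<in> Mon. vlen e = 0 \<and> mlen N e \<le> 2}" for S
  proof -
    let ?L = "C + (\<Sum>e\<in>S. dg e)"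
    have "dg e \<le> ?L" if "e \<in> S" for e using member_le_sum[of e S dg] that S(1) by simp
    then have "card S \<le> (\<Sum>n\<le>?L. card {e \<in> BF 0 n. mlen N e \<le> 2})"
      using S by (intro card_le_sum_degrees) auto
    also have "\<dots> \<le> (\<Sum>n\<le>?L. bidim 0 n + card {v \<in> Vs. deg v + 1 = n})" by (intro sum_mono bidim_0_ge(2))
    also have "\<dots> = (\<Sum>n\<le>?L. bidim 0 n) + (\<Sum>n\<le>?L. card {v \<in> Vs. deg v + 1 = n})"
      by (rule sum.distrib)
    also have "(\<Sum>n\<le>?L. bidim 0 n) = H 0"
      unfolding H_def by (rule sum.mono_neutral_right) (auto simp: hC not_le)
    \<comment> \<open>Each \<open>v\<close> is counted in a single degree, so the corrections add up
      to at most \<open>card Vs\<close>.\<close>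
    also have "(\<Sum>n\<le>?L. card {v \<in> Vs. deg v + 1 = n}) = card (\<Union>n\<le>?L. {v \<in> Vs. deg v + 1 = n})"
      by (rule card_UN_disjoint[symmetric]) (use finite_Vs in auto)
    also have "H 0 + card (\<Union>n\<le>?L. {v \<in> Vs. deg v + 1 = n}) \<le> H 0 + card Vs"
      by (intro add_left_mono card_mono finite_Vs) auto
    finally show ?thesis .
  qed
  have H0_lin: "1 + card Us \<le> H 0"
    using H0[OF linear_monos(1,2)] linear_monos(3) by simp
  \<comment> \<open>Finite-dimensional cohomology turns the Euler series into a polynomial, which
    can be evaluated at 1 and has an order of vanishing there.\<close>
  define E where "E = (\<Sum>k\<le>C. \<Sum>n\<le>C. monom ((-1) ^ k * (of_nat (bidim k n) :: rat)) (k + n))"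
  have E: "fps_of_poly E = euler N"
  proof (rule fps_ext)
    fix w
    let ?g = "\<lambda>k. (-1) ^ k * (of_nat (bidim k (w - k)) :: rat)"
    have inner: "(\<Sum>n\<le>C. coeff (monom ((-1) ^ k * (of_nat (bidim k n) :: rat)) (k + n)) w) =
        (if k \<le> w then ?g k else 0)" for k
    proof (cases "k \<le> w")
      case True
      have "(\<Sum>n\<le>C. coeff (monom ((-1) ^ k * (of_nat (bidim k n) :: rat)) (k + n)) w) =
          (\<Sum>n\<le>C. if n = w - k then ?g k else 0)"
        by (rule sum.cong) (use True in auto)
      also have "\<dots> = ?g k" using hC[of "w - k" k] by simp
      finally show ?thesis using True by simp
    qed (auto intro: sum.neutral)
    have "coeff E w = (\<Sum>k\<le>C. if k \<le> w then ?g k else 0)"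
      unfolding E_def coeff_sum by (intro sum.cong refl inner)
    also have "\<dots> = (\<Sum>k\<in>{k \<in> {..C}. k \<le> w}. ?g k)"
      by (rule sum.inter_filter[symmetric]) simp
    also have "\<dots> = (\<Sum>k\<le>w. ?g k)"
      by (rule sum.mono_neutral_left) (auto intro: hk')
    finally show "fps_of_poly E $ w = euler N $ w" using euler_N_bidim by simp
  qed
  obtain A B where AB: "euler N * fps_of_poly A = fps_of_poly B" "A \<noteq> 0" "B \<noteq> 0"
    "order 1 A = card ?X" "order 1 B = card Vs"
    using euler_product[OF odd order_refl] unfolding X_eq V_eq by blast
  have EA: "E * A = B"
    using AB(1) unfolding E[symmetric] by (simp only: fps_of_poly_mult[symmetric] fps_of_poly_eq_iff)
  then have "order 1 B = order 1 E + order 1 A" using AB(3) order_mult[of E A 1] by simp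
  \<comment> \<open>The excess of \<open>card Vs\<close> over \<open>card ?X\<close> is an order of
    vanishing, hence nonnegative.\<close>
  then have ord: "card Vs = order 1 E + card ?X" using AB(4,5) by simp
  show ?thesis
  proof (cases "order 1 E = 0")
    case True
    then have VX: "card Vs = card ?X" using ord by simp
    have HT: "H 0 \<le> total_Hdim N deg D"
      unfolding total by (rule member_le_sum) auto
    show ?thesis
    proof (cases "?X = {}")
      case True
      then have "card ?X = 0" by (simp only: card.empty)
      then show ?thesis using VX H0_lin HT NUV by linarith
    next
      case False
      then obtain x0 where "x0 \<in> Us" "even (deg x0)" by auto
      then obtain S where "finite S" "S \<subseteq> {e \<in> Mon. vlen e = 0 \<and> mlen N e \<le> 2}"
        "card S + 1 = 1 + card Us + 2 * card ?X"
        by (rule quadratic_monos)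
      \<comment> \<open>With \<open>card Vs = card ?X\<close> this reads
        \<open>card Us + card Vs \<le> H 0\<close>, so V-length 0 alone suffices.\<close>
      then have "card Us + 2 * card ?X \<le> H 0 + card Vs" using H0' by fastforce
      then show ?thesis using VX HT NUV by linarith
    qed
  next
    case False
    define r where "r = order 1 E"
    \<comment> \<open>The alternating sum of the \<open>H k\<close> vanishes, so even and odd
      V-lengths contribute equally and only the even ones have to be bounded.\<close>
    have "poly E 1 = 0" using False order_root by blast
    moreover have "poly E 1 = (\<Sum>k\<le>C. (-1) ^ k * of_nat (H k))"
      by (simp add: E_def H_def poly_sum poly_monom sum_distrib_left)
    moreover have "(\<Sum>k\<le>C. (-1) ^ k * (of_nat (H k) :: rat)) =
        (\<Sum>k\<in>{k \<in> {..C}. even k}. of_nat (H k)) - (\<Sum>k\<in>{k \<in> {..C}. odd k}. of_nat (H k))"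
    proof -
      have "(\<Sum>k\<le>C. (-1) ^ k * (of_nat (H k) :: rat)) =
          (\<Sum>k\<le>C. (if even k then of_nat (H k) else 0) - (if odd k then of_nat (H k) else 0))"
        by (rule sum.cong) auto
      then show ?thesis by (simp only: sum_subtractf sum.inter_filter[OF finite_atMost])
    qed
    ultimately have "(of_nat (\<Sum>k\<in>{k \<in> {..C}. even k}. H k) :: rat) = of_nat (\<Sum>k\<in>{k \<in> {..C}. odd k}. H k)"
      by simp
    then have eo: "(\<Sum>k\<in>{k \<in> {..C}. even k}. H k) = (\<Sum>k\<in>{k \<in> {..C}. odd k}. H k)"
      by (simp only: of_nat_eq_iff)
    have "(\<Sum>k\<le>C. H k) = (\<Sum>k\<le>C. (if even k then H k else 0) + (if odd k then H k else 0))"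
      by (rule sum.cong) auto
    also have "\<dots> = (\<Sum>k\<in>{k \<in> {..C}. even k}. H k) + (\<Sum>k\<in>{k \<in> {..C}. odd k}. H k)"
      by (simp only: sum.distrib sum.inter_filter[OF finite_atMost])
    finally have tot2: "total_Hdim N deg D = 2 * (\<Sum>k\<in>{k \<in> {..C}. even k}. H k)"
      using eo total by simp
    have Hk: "1 \<le> H k \<and> k \<le> C" if kr: "1 \<le> k" "k \<le> r" for k
    proof -
      have "k + card ?X \<le> card Vs" using kr ord r_def by simp
      then have "\<not> exact_on {..<N} k" using not_exact_on[OF odd kr(1)] by simp
      then obtain n where n: "1 \<le> bidim k n" using not_exact_on_bidim kr(1) by blast
      then have "n \<le> C" "k \<le> C" using hC[of n k] hk[of k n] by (cases "C < n"; cases "C < k"; simp)+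
      moreover have "bidim k n \<le> H k" unfolding H_def by (rule member_le_sum) (use \<open>n \<le> C\<close> in auto)
      ultimately show ?thesis using n by simp
    qed
    define q where "q = r div 2"
    have q: "2 * q \<le> r" "r \<le> 2 * q + 1" by (simp_all add: q_def)
    \<comment> \<open>The positive even lengths up to \<open>r\<close> each contribute at least 1 in
      addition to \<open>H 0\<close>.\<close>
    let ?J = "(\<lambda>i. 2 * i) ` {1..q}"
    have J: "\<And>k. k \<in> ?J \<Longrightarrow> 1 \<le> k \<and> k \<le> r \<and> even k" using q(1) by auto
    have "card ?J = card {1..q}" by (rule card_image) (simp add: inj_on_def)
    then have "card ?J = q" by simp
    moreover have "card ?J \<le> sum H ?J"
      unfolding card_eq_sum by (intro sum_mono) (use J Hk in blast)
    moreover have "sum H (insert 0 ?J) = H 0 + sum H ?J"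
      by (rule sum.insert) auto
    moreover have "sum H (insert 0 ?J) \<le> sum H {k \<in> {..C}. even k}"
    proof (rule sum_mono2)
      show "insert 0 ?J \<subseteq> {k \<in> {..C}. even k}" using J Hk by blast
    qed auto
    ultimately have "H 0 + q \<le> sum H {k \<in> {..C}. even k}"
      by linarith
    then have "2 * H 0 + 2 * q \<le> total_Hdim N deg D" unfolding tot2 by simp
    moreover have "card Vs = r + card ?X" using ord r_def by simp
    \<comment> \<open>The left-hand side is at least \<open>2 + 2 * card Us + (r - 1)\<close>, and
      one copy of \<open>card Us\<close> absorbs \<open>card ?X\<close> in
      \<open>N = card Us + r + card ?X\<close>.\<close>
    ultimately show ?thesis using H0_lin XUs NUV q(2) by linarith
  qed
qed

end

theorem theoremA:
  fixes N :: nat and deg :: "nat \<Rightarrow> nat" and D :: "elem \<Rightarrow> elem" and Us :: "nat set"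
  assumes "sullivan_alg N deg D"
    and "minimal N D"
    and "elliptic N deg D"
    and "two_stage N D Us"
  shows "total_Hdim N deg D \<ge> N"
proof -
  interpret two_stage_sullivan N deg D Us
    by unfold_locales (rule assms)+
  show ?thesis by (rule dimension_bound) (rule assms)
qed

end
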